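(* Let $A\subset B$ be an integral ring extension of integral domains, with fields of fractions $K$ and $L$, respectively. Then the function $\mathrm{d}:\mathrm{Spec}(A)\to\mathbb{N}\cup\{\infty\}$ defined by $\mathrm{d}(\mathfrak{p})=\mathrm{d}_{A_{\mathfrak{p}}}(B_{\mathfrak{p}})$ is upper-semicontinuous in any of the following cases: (a) $A\subset B$ is simple, i.e., $B=A[b]$ for some $b\in B$; (b) $A\subset B$ has minimal integral degree, i.e., $\mathrm{d}_K(L)=\mathrm{d}_A(B)$ (for example, this is the case if $B$ is a finitely generated projective $A$-module and the field extension $K\subset L$ is simple; or if $A$ is integrally closed).
   Context: All rings are commutative with unity. For an integral ring extension $A\subset B$ of integral domains and $b\in B$, the integral degree of $b$ over $A$, denoted $\mathrm{id}_A(b)$, is the minimum integer $n\geq 1$ such that $b$ is a root of a monic polynomial of degree $n$ in $A[T]$. The integral degree of $B$ over $A$ is $\mathrm{d}_A(B)=\sup\{\mathrm{id}_A(b)\mid b\in B\}$ (possibly $\infty$); the same definition applies to the algebraic field extension $K\subset L$, giving $\mathrm{d}_K(L)$. For $\mathfrak{p}\in\mathrm{Spec}(A)$, $B_{\mathfrak{p}}$ denotes the localization of $B$ at the multiplicative set $A\setminus\mathfrak{p}$; the extension $A_{\mathfrak{p}}\subset B_{\mathfrak{p}}$ is integral. The function $\mathrm{d}$ is upper-semicontinuous if $\{\mathfrak{p}\in\mathrm{Spec}(A)\mid \mathrm{d}(\mathfrak{p})\geq n\}$ is closed in $\mathrm{Spec}(A)$ (Zariski topology) for every integer $n\geq 1$.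 A field extension $K\subset L$ is simple if $L=K(\alpha)$ for some $\alpha\in L$. *)

theory Defs
  imports
    "HOL-Analysis.Abstract_Topology"
    "HOL-Library.Extended_Nat"
    "HOL-Computational_Algebra.Polynomial"
    "HOL-Computational_Algebra.Fraction_Field"
begin

section \<open>Subrings, integral elements and integral degree\<close>

definition is_subring :: "'a::comm_ring_1 set \<Rightarrow> bool" where
  "is_subring A \<longleftrightarrow> 1 \<in> A \<and> (\<forall>x\<in>A. \<forall>y\<in>A. x - y \<in> A \<and> x * y \<in> A)"

definition is_subfield :: "'a::field set \<Rightarrow> bool" where
  "is_subfield F \<longleftrightarrow> is_subring F \<and> (\<forall>x\<in>F. inverse x \<in> F)"

definition polys_over :: "'a::comm_ring_1 set \<Rightarrow> 'a poly set" where
  "polys_over A = {p. \<forall>i. coeff p i \<in> A}"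

definition root_of_monic :: "'a::comm_ring_1 set \<Rightarrow> nat \<Rightarrow> 'a \<Rightarrow> bool" where
  "root_of_monic A n b \<longleftrightarrow>
     (\<exists>p\<in>polys_over A. lead_coeff p = 1 \<and> degree p = n \<and> poly p b = 0)"

definition integral_over :: "'a::comm_ring_1 set \<Rightarrow> 'a \<Rightarrow> bool" where
  "integral_over A b \<longleftrightarrow> (\<exists>n\<ge>1. root_of_monic A n b)"

definition integral_extension :: "'a::comm_ring_1 set \<Rightarrow> 'a set \<Rightarrow> bool" where
  "integral_extension A B \<longleftrightarrow>
     is_subring A \<and> is_subring B \<and> A \<subseteq> B \<and> (\<forall>b\<in>B. integral_over A b)"

text \<open>For integral \<open>b\<close> the infimum is a minimum; it is \<open>\<infinity>\<close> if \<open>b\<close> is not integral over \<open>A\<close>.\<close>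

definition integral_degree_elem :: "'a::comm_ring_1 set \<Rightarrow> 'a \<Rightarrow> enat" where
  "integral_degree_elem A b = Inf {enat n | n. n \<ge> 1 \<and> root_of_monic A n b}"

definition integral_degree :: "'a::comm_ring_1 set \<Rightarrow> 'a set \<Rightarrow> enat" where
  "integral_degree A B = (SUP b\<in>B. integral_degree_elem A b)"

definition ring_adjoin :: "'a::comm_ring_1 set \<Rightarrow> 'a \<Rightarrow> 'a set" where
  "ring_adjoin A b = {poly p b | p. p \<in> polys_over A}"

definition field_adjoin :: "'a::field set \<Rightarrow> 'a \<Rightarrow> 'a set" where
  "field_adjoin K a = \<Inter>{F. is_subfield F \<and> K \<subseteq> F \<and> a \<in> F}"

section \<open>Localizations and fraction fields\<close>

text \<open>
  For a subring \<open>M\<close> of the domain \<open>'b\<close> and a multiplicative set \<open>S\<close> with \<open>0 \<notin> S\<close>, the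
  localization of \<open>M\<close> at \<open>S\<close> is realized as a subring of the field of fractions \<open>'b fract\<close>.
  For a prime \<open>p\<close> of \<open>A\<close>, both \<open>A\<^sub>p\<close> and \<open>B\<^sub>p\<close> are localizations at \<open>S = A - p\<close>.
\<close>

definition localization :: "'b::idom set \<Rightarrow> 'b set \<Rightarrow> 'b fract set" where
  "localization M S = {Fraction_Field.Fract m s | m s. m \<in> M \<and> s \<in> S}"

definition fraction_field :: "'b::idom set \<Rightarrow> 'b fract set" where
  "fraction_field A = localization A (A - {0})"

definition integrally_closed :: "'b::idom set \<Rightarrow> bool" where
  "integrally_closed A \<longleftrightarrow>
     (\<forall>x\<in>fraction_field A.
        integral_over ((\<lambda>a. Fraction_Field.Fract a 1) ` A) x
        \<longrightarrow> x \<in> (\<lambda>a. Fraction_Field.Fract a 1) ` A)"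

section \<open>The prime spectrum\<close>

definition prime_ideal_of :: "'a::comm_ring_1 set \<Rightarrow> 'a set \<Rightarrow> bool" where
  "prime_ideal_of A P \<longleftrightarrow>
     P \<subset> A \<and> 0 \<in> P \<and> (\<forall>x\<in>P. \<forall>y\<in>P. x + y \<in> P) \<and> (\<forall>a\<in>A. \<forall>x\<in>P. a * x \<in> P) \<and>
     (\<forall>x\<in>A. \<forall>y\<in>A. x * y \<in> P \<longrightarrow> x \<in> P \<or> y \<in> P)"

definition Spec :: "'a::comm_ring_1 set \<Rightarrow> 'a set set" where
  "Spec A = {P. prime_ideal_of A P}"

definition zero_locus :: "'a::comm_ring_1 set \<Rightarrow> 'a set \<Rightarrow> 'a set set" where
  "zero_locus A E = {P \<in> Spec A. E \<subseteq> P}"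

definition zariski_topology :: "'a::comm_ring_1 set \<Rightarrow> 'a set topology" where
  "zariski_topology A = topology (\<lambda>U. \<exists>E\<subseteq>A. U = Spec A - zero_locus A E)"

lemma istopology_zariski:
  assumes "is_subring A"
  shows "istopology (\<lambda>U. \<exists>E\<subseteq>A. U = Spec A - zero_locus A E)"
  unfolding istopology_def
proof (intro conjI allI impI)
  fix U V
  assume "\<exists>E\<subseteq>A. U = Spec A - zero_locus A E" "\<exists>E\<subseteq>A. V = Spec A - zero_locus A E"
  then obtain E F where EF: "E \<subseteq> A" "F \<subseteq> A"
    "U = Spec A - zero_locus A E" "V = Spec A - zero_locus A F" by blast
  let ?G = "{e * f | e f. e \<in> E \<and> f \<in> F}"
  have "?G \<subseteq> A" using EF assms by (auto simp: is_subring_def)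
  moreover have "?G \<subseteq> P \<longleftrightarrow> E \<subseteq> P \<or> F \<subseteq> P" if "P \<in> Spec A" for P
  proof
    assume G: "?G \<subseteq> P"
    show "E \<subseteq> P \<or> F \<subseteq> P"
    proof (rule ccontr)
      assume "\<not> (E \<subseteq> P \<or> F \<subseteq> P)"
      then obtain e f where "e \<in> E" "e \<notin> P" "f \<in> F" "f \<notin> P" by blast
      moreover from this have "e * f \<in> P" using G by blast
      ultimately show False
        using that EF(1,2) unfolding Spec_def prime_ideal_of_def by blast
    qed
  next
    have abs: "a * x \<in> P" if "a \<in> A" "x \<in> P" for a x
      using \<open>P \<in> Spec A\<close> that by (auto simp: Spec_def prime_ideal_of_def)
    assume "E \<subseteq> P \<or> F \<subseteq> P"
    then show "?G \<subseteq> P"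
    proof
      assume "E \<subseteq> P"
      then show ?thesis using abs EF(2) by (subst mult.commute) blast
    next
      assume "F \<subseteq> P"
      then show ?thesis using abs EF(1) by blast
    qed
  qed
  then have "U \<inter> V = Spec A - zero_locus A ?G"
    unfolding EF(3,4) zero_locus_def by blast
  ultimately show "\<exists>E\<subseteq>A. U \<inter> V = Spec A - zero_locus A E" by blast
next
  fix \<K> :: "'a set set set"
  assume "\<forall>K\<in>\<K>. \<exists>E\<subseteq>A. K = Spec A - zero_locus A E"
  then obtain E where E: "\<And>K. K \<in> \<K> \<Longrightarrow> E K \<subseteq> A \<and> K = Spec A - zero_locus A (E K)" by metis
  have "\<Union>\<K> = (\<Union>K\<in>\<K>. Spec A - zero_locus A (E K))" using E by blast
  also have "\<dots> = Spec A - zero_locus A (\<Union>K\<in>\<K>. E K)" by (auto simp: zero_locus_def)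
  finally have "\<Union>\<K> = Spec A - zero_locus A (\<Union>K\<in>\<K>. E K)" .
  moreover have "(\<Union>K\<in>\<K>. E K) \<subseteq> A" using E by blast
  ultimately show "\<exists>E\<subseteq>A. \<Union>\<K> = Spec A - zero_locus A E" by blast
qed

lemma openin_zariski:
  assumes "is_subring A"
  shows "openin (zariski_topology A) U \<longleftrightarrow> (\<exists>E\<subseteq>A. U = Spec A - zero_locus A E)"
  unfolding zariski_topology_def using topology_inverse'[OF istopology_zariski[OF assms]] by simp

lemma topspace_zariski:
  assumes "is_subring A"
  shows "topspace (zariski_topology A) = Spec A"
proof -
  have "zero_locus A A = {}"
    by (auto simp: zero_locus_def Spec_def prime_ideal_of_def)
  then have "openin (zariski_topology A) (Spec A)"
    unfolding openin_zariski[OF assms] by (intro exI[of _ A]) auto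
  then show ?thesis
    using openin_subset[of "zariski_topology A"] openin_topspace[of "zariski_topology A"]
    unfolding openin_zariski[OF assms] by blast
qed

lemma closedin_zariski:
  assumes "is_subring A"
  shows "closedin (zariski_topology A) C \<longleftrightarrow> (\<exists>E\<subseteq>A. C = zero_locus A E)"
proof -
  have "zero_locus A E \<subseteq> Spec A" for E by (auto simp: zero_locus_def)
  then show ?thesis
    unfolding closedin_def topspace_zariski[OF assms] openin_zariski[OF assms] by blast
qed

definition upper_semicontinuous :: "'a topology \<Rightarrow> ('a \<Rightarrow> enat) \<Rightarrow> bool" where
  "upper_semicontinuous X f \<longleftrightarrow>
     (\<forall>n::nat. n \<ge> 1 \<longrightarrow> closedin X {x \<in> topspace X. f x \<ge> enat n})"

section \<open>Finitely generated and projective modules inside a ring\<close>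

text \<open>
  \<open>M\<close> is a subset of a ring containing the subring \<open>A\<close>, regarded as an \<open>A\<close>-module by
  multiplication.
\<close>

definition fin_gen_module :: "'a::comm_ring_1 set \<Rightarrow> 'a set \<Rightarrow> bool" where
  "fin_gen_module A M \<longleftrightarrow>
     (\<exists>S\<subseteq>M. finite S \<and> (\<forall>x\<in>M. \<exists>c. (\<forall>s\<in>S. c s \<in> A) \<and> x = (\<Sum>s\<in>S. c s * s)))"

definition free_module :: "'a::comm_ring_1 set \<Rightarrow> 'i set \<Rightarrow> ('i \<Rightarrow> 'a) set" where
  "free_module A I = {f. range f \<subseteq> A \<and> finite {i. f i \<noteq> 0} \<and> {i. f i \<noteq> 0} \<subseteq> I}"

text \<open>
  A projective module is a direct summand of a free module.  Taking the index set of the free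
  module inside the type of \<open>M\<close> loses nothing: a projective \<open>M\<close> is a direct summand of the free
  module on the set \<open>M\<close>.
\<close>

definition projective_module :: "'a::comm_ring_1 set \<Rightarrow> 'a set \<Rightarrow> bool" where
  "projective_module A M \<longleftrightarrow>
     (\<exists>(I::'a set) \<iota> \<pi>.
        (\<forall>x\<in>M. \<iota> x \<in> free_module A I) \<and>
        (\<forall>x\<in>M. \<forall>y\<in>M. \<iota> (x + y) = (\<lambda>i. \<iota> x i + \<iota> y i)) \<and>
        (\<forall>a\<in>A. \<forall>x\<in>M. \<iota> (a * x) = (\<lambda>i. a * \<iota> x i)) \<and>
        (\<forall>f\<in>free_module A I. \<pi> f \<in> M) \<and>
        (\<forall>f\<in>free_module A I. \<forall>g\<in>free_module A I. \<pi> (\<lambda>i. f i + g i) = \<pi> f + \<pi> g) \<and>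
        (\<forall>a\<in>A. \<forall>f\<in>free_module A I. \<pi> (\<lambda>i. a * f i) = a * \<pi> f) \<and>
        (\<forall>x\<in>M. \<pi> (\<iota> x) = x))"

end

theory Submission
  imports "HOL-Algebra.Algebraic_Closure_Type" "Jordan_Normal_Form.Char_Poly" Defs
begin

text \<open>
  All degree bounds come from the determinant trick: an element stabilizing a nonzero module
  generated by \<open>n\<close> elements of a field is a root of a monic polynomial of degree \<open>n\<close>. Hence
  \<open>id(y) \<le> id(x)\<close> for all \<open>y \<in> A[x]\<close>. If \<open>B = A[b]\<close>, this gives \<open>d(p) = id(b/1)\<close> over \<open>A\<^sub>p\<close>, and
  \<open>d(p) \<ge> m + 1\<close> means that \<open>p\<close> contains the coefficients at \<open>T\<^sup>m\<close> of all polynomials over \<open>A\<close> of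
  degree at most \<open>m\<close> vanishing at \<open>b\<close>, a closed condition. In general
  \<open>d\<^sub>K(L) \<le> d(p) \<le> d\<^sub>A(B)\<close>, so that \<open>d\<close> is constant if the integral degree is minimal.
  If \<open>A\<close> is integrally closed, the minimal polynomial over \<open>K\<close> of an element of \<open>B\<close> has
  coefficients in \<open>A\<close>. If \<open>B\<close> is finitely generated projective and \<open>L = K(\<alpha>)\<close>, the
  characteristic polynomial of multiplication by \<open>b \<in> B\<close> on \<open>L\<close> has coefficients in \<open>A\<close> and degree
  \<open>id\<^sub>K(\<alpha>)\<close>.
\<close>

hide_const (open) Polynomials.degree Polynomials.lead_coeff

section \<open>Subrings and roots of monic polynomials\<close>

lemma is_subringD:
  assumes "is_subring R"
  shows "1 \<in> R" "0 \<in> R"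
    "x \<in> R \<Longrightarrow> y \<in> R \<Longrightarrow> x - y \<in> R" "x \<in> R \<Longrightarrow> y \<in> R \<Longrightarrow> x * y \<in> R"
    "x \<in> R \<Longrightarrow> - x \<in> R" "x \<in> R \<Longrightarrow> y \<in> R \<Longrightarrow> x + y \<in> R" "x \<in> R \<Longrightarrow> x ^ n \<in> R"
proof -
  show one: "1 \<in> R" using assms by (simp add: is_subring_def)
  show diff: "x - y \<in> R" if "x \<in> R" "y \<in> R" for x y
    using assms that by (simp add: is_subring_def)
  show mult: "x * y \<in> R" if "x \<in> R" "y \<in> R" for x y
    using assms that by (simp add: is_subring_def)
  show zero: "0 \<in> R" using diff[OF one one] by simp
  show uminus: "- x \<in> R" if "x \<in> R" for x using diff[OF zero that] by simp
  show "x + y \<in> R" if "x \<in> R" "y \<in> R" using diff[OF that(1) uminus[OF that(2)]] by simp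
  show "x ^ n \<in> R" if "x \<in> R" by (induction n) (auto simp: one mult that)
qed

lemma is_subring_sum:
  assumes "is_subring R" "\<And>i. i \<in> I \<Longrightarrow> f i \<in> R"
  shows "(\<Sum>i\<in>I. f i) \<in> R"
  using assms(2) by (induction I rule: infinite_finite_induct) (auto simp: is_subringD[OF assms(1)])

lemma is_subring_prod:
  assumes "is_subring R" "\<And>i. i \<in> I \<Longrightarrow> f i \<in> R"
  shows "(\<Prod>i\<in>I. f i) \<in> R"
  using assms(2) by (induction I rule: infinite_finite_induct) (auto simp: is_subringD[OF assms(1)])

lemma is_subring_prod_mset:
  assumes "is_subring R" "\<And>i. i \<in># I \<Longrightarrow> f i \<in> R"
  shows "(\<Prod>i\<in>#I. f i) \<in> R"
  using assms(2) by (induction I) (auto simp: is_subringD[OF assms(1)])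

lemma is_subring_polys_over:
  assumes "is_subring R"
  shows "is_subring (polys_over R)"
  using assms
  by (auto simp: is_subring_def polys_over_def coeff_mult one_pCons coeff_pCons is_subringD[OF assms]
           intro!: is_subring_sum[OF assms] split: nat.splits)

lemma pCons_in_polys_over_iff: "pCons a p \<in> polys_over R \<longleftrightarrow> a \<in> R \<and> p \<in> polys_over R"
  by (auto simp: polys_over_def coeff_pCons split: nat.splits)

lemma const_in_polys_over: "is_subring R \<Longrightarrow> a \<in> R \<Longrightarrow> [:a:] \<in> polys_over R"
  by (auto simp: polys_over_def coeff_pCons is_subringD split: nat.splits)

lemma smult_in_polys_over: "is_subring R \<Longrightarrow> a \<in> R \<Longrightarrow> p \<in> polys_over R \<Longrightarrow> smult a p \<in> polys_over R"
  by (auto simp: polys_over_def is_subringD)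

lemma monom_in_polys_over: "is_subring R \<Longrightarrow> a \<in> R \<Longrightarrow> monom a n \<in> polys_over R"
  by (auto simp: polys_over_def coeff_monom is_subringD)

lemma poly_in_subring:
  assumes "is_subring R" "p \<in> polys_over R" "x \<in> R"
  shows "poly p x \<in> R"
  using assms(2) unfolding poly_altdef
  by (intro is_subring_sum[OF assms(1)]) (auto simp: polys_over_def is_subringD[OF assms(1)] assms(3))

text \<open>The Leibniz formula uses only sums, products and signs of the entries. As
  \<open>polys_over R\<close> is itself a subring, this also applies to matrices of polynomials and
  hence to characteristic polynomials.\<close>

lemma det_in_subring:
  assumes "is_subring R" "M \<in> carrier_mat n n"
    and "\<And>i j. i < n \<Longrightarrow> j < n \<Longrightarrow> M $$ (i, j) \<in> R"
  shows "det M \<in> R"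
proof -
  have sg: "signof p \<in> R" for p :: "nat \<Rightarrow> nat"
    by (cases p rule: sign_cases) (simp_all add: is_subringD[OF assms(1)])
  have "p i < n" if "p permutes {0..<n}" "i < n" for p i
    using that permutes_in_image[of p "{0..<n}" i] by simp
  then show ?thesis
    unfolding det_def'[OF assms(2)]
    by (intro is_subring_sum[OF assms(1)] is_subringD(4)[OF assms(1)] is_subring_prod[OF assms(1)] sg)
      (auto intro: assms(3))
qed

lemma char_poly_in_polys_over:
  assumes R: "is_subring R" and M: "M \<in> carrier_mat n n"
    and "\<And>i j. i < n \<Longrightarrow> j < n \<Longrightarrow> M $$ (i, j) \<in> R"
  shows "char_poly M \<in> polys_over R"
  unfolding char_poly_def
proof (rule det_in_subring[OF is_subring_polys_over[OF R] char_poly_matrix_closed[OF M]])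
  fix i j assume "i < n" "j < n"
  then show "char_poly_matrix M $$ (i, j) \<in> polys_over R"
    using M assms(3) R
    by (auto simp: char_poly_matrix_def pCons_in_polys_over_iff const_in_polys_over is_subringD
        is_subringD[OF is_subring_polys_over[OF R]])
qed

section \<open>Roots of monic polynomials and comparison of integral degrees\<close>

lemma root_of_monicI:
  "p \<in> polys_over R \<Longrightarrow> lead_coeff p = 1 \<Longrightarrow> poly p x = 0 \<Longrightarrow> root_of_monic R (degree p) x"
  by (auto simp: root_of_monic_def)

text \<open>The only monic polynomial of degree 0 is 1. The bound \<open>n \<ge> 1\<close> in the
  definitions of integrality and integral degree is therefore automatic.\<close>

lemma not_root_of_monic_0 [simp]: "\<not> root_of_monic R 0 x"
  by (auto simp: root_of_monic_def elim!: degree_eq_zeroE)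

lemma integral_over_iff: "integral_over R x \<longleftrightarrow> (\<exists>n. root_of_monic R n x)"
  unfolding integral_over_def by (metis One_nat_def Suc_leI not_gr_zero not_root_of_monic_0)

lemma root_of_monic_subset: "root_of_monic R n x \<Longrightarrow> R \<subseteq> S \<Longrightarrow> root_of_monic S n x"
  by (auto simp: root_of_monic_def polys_over_def)

text \<open>Multiplication by a power of the indeterminate raises the degree. The admissible degrees
  are thus upward closed, and inequalities of integral degrees become implications between
  \<open>root_of_monic\<close> statements.\<close>

lemma root_of_monic_mono:
  fixes x :: "'a::idom"
  assumes "is_subring R" "root_of_monic R m x" "m \<le> n"
  shows "root_of_monic R n x"
proof -
  obtain p where p: "p \<in> polys_over R" "lead_coeff p = 1" "degree p = m" "poly p x = 0"
    using assms(2) by (auto simp: root_of_monic_def)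
  let ?q = "monom 1 (n - m) * p"
  have "p \<noteq> 0" using p(2) by auto
  then have "degree ?q = n"
    using p(3) assms(3) by (subst degree_mult_eq) (auto simp: degree_monom_eq)
  moreover have "lead_coeff ?q = 1" using p(2) by (simp add: lead_coeff_mult degree_monom_eq)
  moreover have "?q \<in> polys_over R"
    using p(1) assms(1)
    by (intro is_subringD(4)[OF is_subring_polys_over]) (auto simp: monom_in_polys_over is_subringD)
  ultimately show ?thesis using p(4) unfolding root_of_monic_def by (intro bexI[of _ ?q]) auto
qed

lemma integral_degree_elem_le_iff:
  fixes x :: "'a::idom"
  assumes "is_subring R"
  shows "integral_degree_elem R x \<le> enat n \<longleftrightarrow> root_of_monic R n x"
proof
  let ?S = "{enat n | n. n \<ge> 1 \<and> root_of_monic R n x}"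
  assume le: "integral_degree_elem R x \<le> enat n"
  \<comment> \<open>The infimum of the empty set in \<open>enat\<close> is infinity; a nonempty set
    attains its infimum.\<close>
  then have "?S \<noteq> {}" by (auto simp: integral_degree_elem_def Inf_enat_def split: if_splits)
  then have "Inf ?S \<in> ?S" unfolding Inf_enat_def by (metis (mono_tags, lifting) LeastI_ex ex_in_conv)
  then obtain m where "Inf ?S = enat m" "root_of_monic R m x" by auto
  with le show "root_of_monic R n x"
    using root_of_monic_mono[OF assms] by (auto simp: integral_degree_elem_def)
next
  assume "root_of_monic R n x"
  moreover from this have "n \<ge> 1" by (cases n) auto
  ultimately show "integral_degree_elem R x \<le> enat n"
    unfolding integral_degree_elem_def by (intro Inf_lower) auto
qed

text \<open>The two elements may lie in different domains, so that an element of B can be compared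
  with a fraction in L.\<close>

lemma integral_degree_elem_le:
  fixes x :: "'a::idom" and y :: "'c::idom"
  assumes "is_subring R" "is_subring S" "\<And>n. root_of_monic R n x \<Longrightarrow> root_of_monic S n y"
  shows "integral_degree_elem S y \<le> integral_degree_elem R x"
proof (cases "integral_degree_elem R x")
  case (enat n)
  then have "root_of_monic R n x" using integral_degree_elem_le_iff[OF assms(1)] by (metis order_refl)
  then show ?thesis using integral_degree_elem_le_iff[OF assms(2)] assms(3) enat by metis
qed simp

lemma root_of_monic_hom:
  assumes "inj_comm_ring_hom h"
  shows "root_of_monic (h ` R) n (h x) \<longleftrightarrow> root_of_monic R n x"
proof -
  interpret inj_comm_ring_hom h by fact
  have surj: "\<exists>p\<in>polys_over R. map_poly h p = q" if "q \<in> polys_over (h ` R)" for q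
    using that
  proof (induction q)
    case 0
    \<comment> \<open>\<open>R\<close> is an arbitrary set here, so that 0 belongs to it must be
      read off from the zero polynomial by injectivity.\<close>
    then obtain c where "c \<in> R" "h c = 0" unfolding polys_over_def by fastforce
    then have "0 \<in> polys_over R" unfolding polys_over_def by simp
    then show ?case using map_poly_0 by blast
  next
    case (pCons a q)
    then obtain p c where "p \<in> polys_over R" "map_poly h p = q" "c \<in> R" "a = h c"
      by (auto simp: pCons_in_polys_over_iff)
    then show ?case
      by (intro bexI[of _ "pCons c p"]) (auto simp: pCons_in_polys_over_iff map_poly_pCons_hom)
  qed
  have "map_poly h p \<in> polys_over (h ` R)" if "p \<in> polys_over R" for p
    using that by (auto simp: polys_over_def)
  then have "polys_over (h ` R) = map_poly h ` polys_over R" using surj by blast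
  then show ?thesis unfolding root_of_monic_def by simp
qed

lemma is_subring_hom_image:
  assumes "comm_ring_hom h" "is_subring R"
  shows "is_subring (h ` R)"
proof -
  interpret comm_ring_hom h by fact
  show ?thesis
    using assms(2) unfolding is_subring_def
    by (auto simp flip: hom_mult hom_minus intro!: imageI image_eqI[of _ h 1])
qed

section \<open>Adjoining an element\<close>

text \<open>The relations make the vector \<open>v\<close> an eigenvector of \<open>M\<close> with
  eigenvalue \<open>x\<close>; its entry at \<open>i0\<close> shows that it is nonzero.\<close>

lemma poly_char_poly_eq_0:
  fixes x :: "'a::field"
  assumes M: "M \<in> carrier_mat n n" and v: "i0 < n" "v i0 \<noteq> 0"
    and stable: "\<And>i. i < n \<Longrightarrow> x * v i = (\<Sum>j<n. M $$ (i, j) * v j)"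
  shows "poly (char_poly M) x = 0"
proof -
  let ?w = "vec n v"
  have "M *\<^sub>v ?w = x \<cdot>\<^sub>v ?w"
    using M stable by (intro eq_vecI) (auto simp: scalar_prod_def atLeast0LessThan)
  moreover have "?w \<noteq> 0\<^sub>v n" using v by (metis index_vec index_zero_vec(1))
  ultimately have "eigenvector M ?w x" using M by (simp add: eigenvector_def)
  then show ?thesis using eigenvalue_root_char_poly[OF M] by (auto simp: eigenvalue_def)
qed

text \<open>This is the determinant trick. The index set is an arbitrary finite set so that
  generators of a tower can be indexed by pairs.\<close>

lemma root_of_monic_if_stable:
  fixes x :: "'a::field"
  assumes R: "is_subring R" and I: "finite I" and v: "i0 \<in> I" "v i0 \<noteq> 0"
    and M: "\<And>i j. i \<in> I \<Longrightarrow> j \<in> I \<Longrightarrow> M i j \<in> R"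
    and stable: "\<And>i. i \<in> I \<Longrightarrow> x * v i = (\<Sum>j\<in>I. M i j * v j)"
  shows "root_of_monic R (card I) x"
proof -
  define n where "n = card I"
  obtain h where h: "bij_betw h {..<n} I"
    unfolding n_def using ex_bij_betw_nat_finite[OF I] by (auto simp: atLeast0LessThan)
  have hI: "h i \<in> I" if "i < n" for i using h that by (auto simp: bij_betw_def)
  define N where "N = mat n n (\<lambda>(i, j). M (h i) (h j))"
  have N: "N \<in> carrier_mat n n" by (simp add: N_def)
  obtain k where k: "k < n" "h k = i0"
    using v(1) h unfolding bij_betw_def by (metis lessThan_iff imageE)
  have "poly (char_poly N) x = 0"
  proof (rule poly_char_poly_eq_0[OF N k(1)])
    show "v (h k) \<noteq> 0" using v(2) k(2) by simp
    fix i assume i: "i < n"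
    have "(\<Sum>j<n. M (h i) (h j) * v (h j)) = (\<Sum>j\<in>I. M (h i) j * v j)"
      by (rule sum.reindex_bij_betw[OF h])
    then show "x * v (h i) = (\<Sum>j<n. N $$ (i, j) * v (h j))"
      using stable[OF hI[OF i]] i by (simp add: N_def)
  qed
  moreover have "char_poly N \<in> polys_over R"
    using M hI by (intro char_poly_in_polys_over[OF R N]) (simp add: N_def)
  ultimately show ?thesis
    using root_of_monicI[of "char_poly N" R x] degree_monic_char_poly[OF N] by (simp add: n_def)
qed

text \<open>No coefficient has to be inverted when dividing by a monic polynomial. Bounding the
  remainder by vanishing coefficients also covers \<open>degree g = 0\<close>, where it must be
  zero.\<close>

lemma monic_division:
  assumes R: "is_subring R" and g: "g \<in> polys_over R" "lead_coeff g = 1" and f: "f \<in> polys_over R"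
  obtains q r where "q \<in> polys_over R" "r \<in> polys_over R" "f = q * g + r"
    "\<And>i. i \<ge> degree g \<Longrightarrow> coeff r i = 0"
proof -
  note sub = is_subringD[OF is_subring_polys_over[OF R]]
  from f have "\<exists>q\<in>polys_over R. \<exists>r\<in>polys_over R. f = q * g + r \<and> (\<forall>i\<ge>degree g. coeff r i = 0)"
  proof (induction f)
    case 0
    then show ?case by (intro bexI[of _ 0]) (auto simp: sub)
  next
    case (pCons a f)
    then obtain q r where qr: "q \<in> polys_over R" "r \<in> polys_over R" "f = q * g + r"
      "\<forall>i\<ge>degree g. coeff r i = 0" by (auto simp: pCons_in_polys_over_iff)
    have a: "a \<in> R" using pCons.prems by (simp add: pCons_in_polys_over_iff)
    \<comment> \<open>The shifted remainder \<open>pCons a r\<close> can have a coefficient at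
      \<open>degree g\<close>; subtracting \<open>c\<close> times the monic \<open>g\<close> removes
      it.\<close>
    define c where "c = coeff (pCons a r) (degree g)"
    have ar: "pCons a r \<in> polys_over R" using a qr(2) by (simp add: pCons_in_polys_over_iff)
    then have c: "c \<in> R" by (auto simp: c_def polys_over_def)
    have "coeff (pCons a r - smult c g) i = 0" if "i \<ge> degree g" for i
    proof (cases "i = degree g")
      case True
      then show ?thesis using g(2) by (simp add: c_def)
    next
      case False
      then have "coeff g i = 0" "coeff (pCons a r) i = 0"
        using that qr(4) by (auto simp: coeff_eq_0 coeff_pCons split: nat.splits)
      then show ?thesis by simp
    qed
    moreover have "pCons a f = pCons c q * g + (pCons a r - smult c g)"
      by (simp add: qr(3))
    ultimately show ?case
      using ar c qr(1) g(1) R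
      by (intro bexI[of _ "pCons c q"] bexI[of _ "pCons a r - smult c g"])
        (auto simp: pCons_in_polys_over_iff smult_in_polys_over intro!: sub)
  qed
  then show ?thesis using that by blast
qed

lemma ring_adjoin_eq_image: "ring_adjoin R x = (\<lambda>p. poly p x) ` polys_over R"
  by (auto simp: ring_adjoin_def)

lemma is_subring_ring_adjoin:
  assumes "is_subring R"
  shows "is_subring (ring_adjoin R x)"
  unfolding ring_adjoin_eq_image
  by (intro is_subring_hom_image is_subring_polys_over assms) (unfold_locales, auto)

lemma ring_adjoin_self: "is_subring R \<Longrightarrow> x \<in> ring_adjoin R x"
  unfolding ring_adjoin_def
  by (intro CollectI exI[of _ "[:0, 1:]"]) (auto simp: pCons_in_polys_over_iff const_in_polys_over is_subringD
      is_subringD[OF is_subring_polys_over])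

lemma subset_ring_adjoin:
  assumes "is_subring R"
  shows "R \<subseteq> ring_adjoin R x"
proof
  fix a assume "a \<in> R"
  then show "a \<in> ring_adjoin R x"
    unfolding ring_adjoin_def using const_in_polys_over[OF assms]
    by (intro CollectI exI[of _ "[:a:]"]) simp
qed

lemma ring_adjoin_least:
  "is_subring S \<Longrightarrow> R \<subseteq> S \<Longrightarrow> x \<in> S \<Longrightarrow> ring_adjoin R x \<subseteq> S"
  unfolding ring_adjoin_def using poly_in_subring[of S _ x] by (auto simp: polys_over_def)

text \<open>Reduction modulo a monic polynomial vanishing at \<open>x\<close> leaves only the powers
  of \<open>x\<close> below its degree as generators.\<close>

lemma ring_adjoin_power_sum:
  assumes R: "is_subring R" and x: "root_of_monic R n x" and y: "y \<in> ring_adjoin R x"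
  obtains c where "\<And>i. c i \<in> R" "y = (\<Sum>i<n. c i * x ^ i)"
proof -
  obtain f where f: "f \<in> polys_over R" "y = poly f x" using y by (auto simp: ring_adjoin_def)
  obtain g where g: "g \<in> polys_over R" "lead_coeff g = 1" "degree g = n" "poly g x = 0"
    using x by (auto simp: root_of_monic_def)
  obtain q r where r: "q \<in> polys_over R" "r \<in> polys_over R" "f = q * g + r"
    "\<And>i. i \<ge> n \<Longrightarrow> coeff r i = 0"
    using monic_division[OF R g(1,2) f(1)] g(3) by metis
  have "n > 0" using x by (cases n) auto
  then have "degree r < n" using r(4) by (metis degree_0 leading_coeff_0_iff linorder_not_less)
  have "y = poly r x" using f(2) r(3) g(4) by simp
  also have "\<dots> = (\<Sum>i\<le>degree r. coeff r i * x ^ i)" by (rule poly_altdef)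
  also have "\<dots> = (\<Sum>i<n. coeff r i * x ^ i)"
    using \<open>degree r < n\<close> by (intro sum.mono_neutral_left) (auto simp: coeff_eq_0)
  finally show ?thesis using that[of "coeff r"] r(2) by (auto simp: polys_over_def)
qed

text \<open>Multiplication by \<open>y\<close> stabilizes R[x], which is generated by the
  \<open>n\<close> powers of \<open>x\<close> below \<open>n\<close>, among them
  \<open>x ^ 0 = 1\<close>, which is nonzero.\<close>

lemma root_of_monic_ring_adjoin:
  fixes x :: "'a::field"
  assumes R: "is_subring R" and x: "root_of_monic R n x" and y: "y \<in> ring_adjoin R x"
  shows "root_of_monic R n y"
proof -
  have "n > 0" using x by (cases n) auto
  have "y * x ^ i \<in> ring_adjoin R x" for i
    using y ring_adjoin_self[OF R] is_subringD[OF is_subring_ring_adjoin[OF R]] by metis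
  then have "\<exists>c. (\<forall>j. c j \<in> R) \<and> y * x ^ i = (\<Sum>j<n. c j * x ^ j)" for i
    using ring_adjoin_power_sum[OF R x] by metis
  then obtain M where "\<And>i j. M i j \<in> R" "\<And>i. y * x ^ i = (\<Sum>j<n. M i j * x ^ j)" by metis
  then have "root_of_monic R (card {..<n}) y"
    using \<open>n > 0\<close> by (intro root_of_monic_if_stable[OF R, of _ 0 "\<lambda>i. x ^ i" M]) auto
  then show ?thesis by simp
qed

text \<open>The \<open>m * n\<close> products \<open>x ^ i * y ^ j\<close> generate R[x][y] over
  \<open>R\<close>: expand first in powers of \<open>y\<close> over R[x], then each coefficient in
  powers of \<open>x\<close> over \<open>R\<close>.\<close>

lemma root_of_monic_tower:
  fixes x :: "'a::field"
  assumes R: "is_subring R" and x: "root_of_monic R m x"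
    and y: "root_of_monic (ring_adjoin R x) n y" and z: "z \<in> ring_adjoin (ring_adjoin R x) y"
  shows "root_of_monic R (m * n) z"
proof -
  let ?S = "ring_adjoin R x"
  note S = is_subring_ring_adjoin[OF R, of x]
  note T = is_subringD(4,7)[OF is_subring_ring_adjoin[OF S]]
  have pos: "m > 0" "n > 0" using x y by (cases m; auto; fail) (use y in \<open>cases n; auto\<close>)
  have "x \<in> ring_adjoin ?S y" using ring_adjoin_self[OF R] subset_ring_adjoin[OF S] by blast
  then have "z * (x ^ i * y ^ j) \<in> ring_adjoin ?S y" for i j
    by (intro T z ring_adjoin_self[OF S])
  then have "\<exists>c. (\<forall>l. c l \<in> ?S) \<and> z * (x ^ i * y ^ j) = (\<Sum>l<n. c l * y ^ l)" for i j
    using ring_adjoin_power_sum[OF S y] by metis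
  then obtain c where c: "\<And>i j l. c i j l \<in> ?S"
    "\<And>i j. z * (x ^ i * y ^ j) = (\<Sum>l<n. c i j l * y ^ l)" by metis
  have "\<exists>d. (\<forall>k. d k \<in> R) \<and> c i j l = (\<Sum>k<m. d k * x ^ k)" for i j l
    using ring_adjoin_power_sum[OF R x c(1)] by metis
  then obtain d where d: "\<And>i j l k. d i j l k \<in> R"
    "\<And>i j l. c i j l = (\<Sum>k<m. d i j l k * x ^ k)" by metis
  have "z * (x ^ i * y ^ j) = (\<Sum>p\<in>{..<m} \<times> {..<n}. d i j (snd p) (fst p) * (x ^ fst p * y ^ snd p))"
    for i j
  proof -
    have "z * (x ^ i * y ^ j) = (\<Sum>l<n. \<Sum>k<m. d i j l k * (x ^ k * y ^ l))"
      unfolding c(2) d(2) by (simp add: sum_distrib_right mult.assoc)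
    also have "\<dots> = (\<Sum>k<m. \<Sum>l<n. d i j l k * (x ^ k * y ^ l))" by (rule sum.swap)
    finally show ?thesis by (simp add: sum.cartesian_product case_prod_unfold)
  qed
  then have "root_of_monic R (card ({..<m} \<times> {..<n})) z"
    using d(1) pos
    by (intro root_of_monic_if_stable[OF R, of _ "(0, 0)" "\<lambda>p. x ^ fst p * y ^ snd p"
          "\<lambda>p q. d (fst p) (snd p) (snd q) (fst q)"]) auto
  then show ?thesis by (simp add: card_cartesian_product)
qed

text \<open>Differences and products of \<open>x\<close> and \<open>y\<close> lie in R[x][y], all of
  whose elements are integral over \<open>R\<close> by the tower bound.\<close>

lemma is_subring_integral_closure:
  fixes R :: "'a::field set"
  assumes R: "is_subring R"
  shows "is_subring {x. integral_over R x}"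
proof -
  have "integral_over R z"
    if "integral_over R x" "integral_over R y" "z \<in> ring_adjoin (ring_adjoin R x) y" for x y z
    using that root_of_monic_tower[OF R] root_of_monic_subset[OF _ subset_ring_adjoin[OF R]]
    unfolding integral_over_iff by metis
  moreover have "x - y \<in> ring_adjoin (ring_adjoin R x) y" "x * y \<in> ring_adjoin (ring_adjoin R x) y"
    for x y
    using ring_adjoin_self[OF R, of x] ring_adjoin_self[OF is_subring_ring_adjoin[OF R], of y x]
      subset_ring_adjoin[OF is_subring_ring_adjoin[OF R], of x y]
      is_subringD[OF is_subring_ring_adjoin[OF is_subring_ring_adjoin[OF R], of x y]] by blast+
  moreover have "integral_over R 1"
    unfolding integral_over_def root_of_monic_def
    by (intro exI[of _ 1] conjI bexI[of _ "[:-1, 1:]"])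
      (auto simp: pCons_in_polys_over_iff is_subringD[OF R] is_subringD[OF is_subring_polys_over[OF R]])
  ultimately show ?thesis unfolding is_subring_def by blast
qed

section \<open>Linear algebra over subfields and inverses of integral elements\<close>

lemma is_subfieldD:
  assumes "is_subfield K"
  shows "is_subring K" "x \<in> K \<Longrightarrow> inverse x \<in> K" "x \<in> K \<Longrightarrow> y \<in> K \<Longrightarrow> x / y \<in> K"
  using assms is_subringD[of K] by (auto simp: is_subfield_def field_class.field_divide_inverse)

text \<open>Otherwise division by the leading coefficient would give a monic polynomial over
  \<open>K\<close> of degree below \<open>n\<close> vanishing at \<open>x\<close>.\<close>

lemma eq_0_if_low_degree_root:
  assumes K: "is_subfield K" and min: "\<And>m. root_of_monic K m x \<Longrightarrow> n \<le> m"
    and p: "p \<in> polys_over K" "poly p x = 0" "\<And>i. i \<ge> n \<Longrightarrow> coeff p i = 0"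
  shows "p = 0"
proof (rule ccontr)
  assume "p \<noteq> 0"
  let ?q = "smult (inverse (lead_coeff p)) p"
  have "?q \<in> polys_over K"
    using p(1) is_subfieldD[OF K]
    by (intro smult_in_polys_over) (auto simp: polys_over_def)
  then have "root_of_monic K (degree ?q) x"
    using \<open>p \<noteq> 0\<close> p(2) by (intro root_of_monicI) auto
  then have "n \<le> degree p" using min \<open>p \<noteq> 0\<close> by force
  then show False using p(3)[of "degree p"] \<open>p \<noteq> 0\<close> by simp
qed

text \<open>This is the linear independence over \<open>K\<close> of the powers of \<open>x\<close>
  below its degree; it makes coordinates with respect to them unique.\<close>

lemma power_sum_inject:
  fixes a b :: "nat \<Rightarrow> 'a::field"
  assumes K: "is_subfield K" and min: "\<And>m. root_of_monic K m x \<Longrightarrow> n \<le> m"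
    and ab: "\<And>i. i < n \<Longrightarrow> a i \<in> K" "\<And>i. i < n \<Longrightarrow> b i \<in> K"
    and eq: "(\<Sum>i<n. a i * x ^ i) = (\<Sum>i<n. b i * x ^ i)"
    and i: "i < n"
  shows "a i = b i"
proof -
  let ?p = "\<Sum>i<n. monom (a i - b i) i"
  have coeff: "coeff ?p j = (if j < n then a j - b j else 0)" for j
    by (auto simp: coeff_sum coeff_monom)
  have "?p = 0"
  proof (rule eq_0_if_low_degree_root[OF K min])
    show "?p \<in> polys_over K"
      using ab is_subringD[OF is_subfieldD(1)[OF K]] by (auto simp: polys_over_def coeff)
    show "poly ?p x = 0"
      using eq by (simp add: poly_sum poly_monom left_diff_distrib sum_subtractf)
  qed (auto simp: coeff)
  then show ?thesis using coeff[of i] i by simp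
qed

lemma root_of_monic_least:
  assumes "integral_over K x"
  obtains n where "root_of_monic K n x" "\<And>m. root_of_monic K m x \<Longrightarrow> n \<le> m"
  using assms LeastI_ex[of "\<lambda>n. root_of_monic K n x"] Least_le[of "\<lambda>n. root_of_monic K n x"]
  unfolding integral_over_iff by blast

text \<open>Write a monic relation of least degree as \<open>c + x * poly q x = 0\<close>. Since
  \<open>q\<close> is monic of smaller degree, minimality gives \<open>poly q x \<noteq> 0\<close>,
  so \<open>x * poly q x = - c\<close> is a nonzero element of \<open>R\<close>.\<close>

lemma multiple_in_subring:
  fixes x :: "'a::idom"
  assumes R: "is_subring R" and x: "integral_over R x" "x \<noteq> 0"
  obtains w where "w \<in> ring_adjoin R x" "x * w \<in> R" "x * w \<noteq> 0"
proof -
  obtain n where n: "root_of_monic R n x" "\<And>m. root_of_monic R m x \<Longrightarrow> n \<le> m"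
    using root_of_monic_least[OF x(1)] by blast
  then obtain p where p: "p \<in> polys_over R" "lead_coeff p = 1" "degree p = n" "poly p x = 0"
    by (auto simp: root_of_monic_def)
  obtain c q where cq: "p = pCons c q" by (cases p) auto
  have q: "q \<in> polys_over R" and c: "c \<in> R" using p(1) by (auto simp: cq pCons_in_polys_over_iff)
  have eq: "x * poly q x = - c" using p(4) unfolding cq by (simp add: eq_neg_iff_add_eq_0 add.commute)
  have "q \<noteq> 0"
  proof
    assume "q = 0"
    then show False using n(1) p(3) cq by simp
  qed
  have "poly q x \<noteq> 0"
  proof
    assume "poly q x = 0"
    then have "root_of_monic R (degree q) x"
      using q p(2) \<open>q \<noteq> 0\<close> by (intro root_of_monicI) (auto simp: cq)
    then show False using n(2) p(3) \<open>q \<noteq> 0\<close> by (force simp: cq)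
  qed
  then have "x * poly q x \<noteq> 0" using x(2) by simp
  moreover have "poly q x \<in> ring_adjoin R x" using q by (auto simp: ring_adjoin_def)
  moreover have "x * poly q x \<in> R" unfolding eq by (rule is_subringD(5)[OF R c])
  ultimately show ?thesis using that by blast
qed

text \<open>For nonzero \<open>y\<close> some multiple \<open>y * w\<close> with \<open>w\<close> in
  K[y] is a nonzero element of \<open>K\<close>, hence
  \<open>inverse y = w * inverse (y * w)\<close> lies in K[x].\<close>

lemma is_subfield_ring_adjoin:
  fixes x :: "'a::field"
  assumes K: "is_subfield K" and int: "\<And>y. integral_over K y"
  shows "is_subfield (ring_adjoin K x)"
  unfolding is_subfield_def
proof (intro conjI ballI)
  note R = is_subfieldD(1)[OF K]
  note S = is_subring_ring_adjoin[OF R, of x]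
  show "is_subring (ring_adjoin K x)" by (rule S)
  fix y assume y: "y \<in> ring_adjoin K x"
  show "inverse y \<in> ring_adjoin K x"
  proof (cases "y = 0")
    case False
    then obtain w where w: "w \<in> ring_adjoin K y" "y * w \<in> K" "y * w \<noteq> 0"
      using multiple_in_subring[OF R int] by blast
    have "inverse y = w * inverse (y * w)" using w(3) by (simp add: field_simps)
    moreover have "w \<in> ring_adjoin K x"
      using w(1) ring_adjoin_least[OF S subset_ring_adjoin[OF R] y] by blast
    moreover have "inverse (y * w) \<in> ring_adjoin K x"
      using w(2) is_subfieldD(2)[OF K] subset_ring_adjoin[OF R] by blast
    ultimately show ?thesis using is_subringD(4)[OF S] by metis
  qed (simp add: is_subringD[OF S])
qed

section \<open>Localizations\<close>

lemma inj_comm_ring_hom_to_fract: "inj_comm_ring_hom to_fract"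
  by unfold_locales auto

lemma Fract_eq_divide: "Fraction_Field.Fract a b = to_fract a / to_fract b"
  by (simp add: to_fract_def)

lemma localization_eq: "localization M S = {to_fract m / to_fract s | m s. m \<in> M \<and> s \<in> S}"
  by (simp add: localization_def Fract_eq_divide)

lemma localizationI: "m \<in> M \<Longrightarrow> s \<in> S \<Longrightarrow> to_fract m / to_fract s \<in> localization M S"
  by (auto simp: localization_eq)

lemma root_of_monic_to_fract: "root_of_monic (to_fract ` R) n (to_fract x) \<longleftrightarrow> root_of_monic R n x"
  by (rule root_of_monic_hom[OF inj_comm_ring_hom_to_fract])

text \<open>Both \<open>A - p\<close> for a prime \<open>p\<close> and \<open>A - {0}\<close> are
  instances, so that the localizations at primes and the fraction field are treated
  together.\<close>

locale multiplicative_subset =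
  fixes A S :: "'b::idom set"
  assumes subring: "is_subring A"
    and subset: "S \<subseteq> A" and one: "1 \<in> S" and zero: "0 \<notin> S"
    and mult: "\<And>s t. s \<in> S \<Longrightarrow> t \<in> S \<Longrightarrow> s * t \<in> S"
begin

lemma is_subring_localization:
  assumes "is_subring M" "A \<subseteq> M"
  shows "is_subring (localization M S)"
  unfolding is_subring_def
proof (intro conjI ballI)
  have sM: "s \<in> M" if "s \<in> S" for s using that subset assms(2) by blast
  note D = is_subringD[OF assms(1)]
  show "1 \<in> localization M S" unfolding localization_eq using one D(1)
    by (intro CollectI exI[of _ 1]) simp
  fix x y assume "x \<in> localization M S" "y \<in> localization M S"
  then obtain a b s t where *: "a \<in> M" "b \<in> M" "s \<in> S" "t \<in> S"
    "x = to_fract a / to_fract s" "y = to_fract b / to_fract t" by (auto simp: localization_eq)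
  then have nz: "to_fract s \<noteq> 0" "to_fract t \<noteq> 0" using zero by auto
  have "x - y = to_fract (a * t - b * s) / to_fract (s * t)"
    unfolding *(5,6) using nz by (simp add: field_simps)
  also have "\<dots> \<in> localization M S"
    by (intro localizationI D(3) D(4) mult * sM)
  finally show "x - y \<in> localization M S" .
  have "x * y = to_fract (a * b) / to_fract (s * t)"
    unfolding *(5,6) using nz by (simp add: field_simps)
  also have "\<dots> \<in> localization M S"
    by (intro localizationI D(4) mult *)
  finally show "x * y \<in> localization M S" .
qed

lemmas is_subring_localization' = is_subring_localization[OF subring order_refl]

lemma to_fract_in_localization: "m \<in> M \<Longrightarrow> to_fract m \<in> localization M S"
  unfolding localization_eq using one by (intro CollectI exI[of _ m] exI[of _ 1]) simp

lemma inverse_in_localization: "s \<in> S \<Longrightarrow> inverse (to_fract s) \<in> localization A S"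
  unfolding localization_eq using is_subringD(1)[OF subring]
  by (intro CollectI exI[of _ 1] exI[of _ s]) (simp add: field_class.field_divide_inverse)

text \<open>As the inverse of \<open>s\<close> lies in \<open>R\<close>, the quotient lies in R[x];
  dividing by denominators does not raise the degree.\<close>

lemma root_of_monic_divide:
  assumes R: "is_subring R" "localization A S \<subseteq> R" and "s \<in> S" "root_of_monic R n x"
  shows "root_of_monic R n (x / to_fract s)"
proof (rule root_of_monic_ring_adjoin[OF R(1) assms(4)])
  have "inverse (to_fract s) \<in> ring_adjoin R x"
    using inverse_in_localization[OF assms(3)] R subset_ring_adjoin[OF R(1)] by blast
  then show "x / to_fract s \<in> ring_adjoin R x"
    unfolding field_class.field_divide_inverse
    by (rule is_subringD(4)[OF is_subring_ring_adjoin[OF R(1)] ring_adjoin_self[OF R(1)]])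
qed

lemma root_of_monic_localization:
  "root_of_monic A n b \<Longrightarrow> root_of_monic (localization A S) n (to_fract b)"
  using root_of_monic_to_fract[of A n b] to_fract_in_localization
  by (auto intro: root_of_monic_subset)

lemma integral_degree_localization_le:
  "integral_degree (localization A S) (localization UNIV S) \<le> integral_degree A UNIV"
  unfolding integral_degree_def
proof (rule SUP_mono)
  fix y assume "y \<in> localization UNIV S"
  then obtain b s where y: "s \<in> S" "y = to_fract b / to_fract s" by (auto simp: localization_eq)
  have "integral_degree_elem (localization A S) y \<le> integral_degree_elem A b"
    unfolding y(2)
    by (intro integral_degree_elem_le root_of_monic_divide root_of_monic_localization y
        subring is_subring_localization' order_refl)
  then show "\<exists>b\<in>UNIV. integral_degree_elem (localization A S) y \<le> integral_degree_elem A b"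
    by blast
qed

lemma localization_subset_fraction_field: "localization A S \<subseteq> fraction_field A"
  unfolding fraction_field_def localization_eq using subset zero by blast

lemma clear_denominators:
  assumes "p \<in> polys_over (localization A S)"
  obtains s q where "s \<in> S" "q \<in> polys_over A" "smult (to_fract s) p = map_poly to_fract q"
proof -
  interpret inj_comm_ring_hom "to_fract :: 'b \<Rightarrow> 'b fract" by (rule inj_comm_ring_hom_to_fract)
  from assms have "\<exists>s\<in>S. \<exists>q\<in>polys_over A. smult (to_fract s) p = map_poly to_fract q"
  proof (induction p)
    case 0
    then show ?case
      using one is_subringD(2)[OF is_subring_polys_over[OF subring]]
      by (intro bexI[of _ 1] bexI[of _ 0]) auto
  next
    case (pCons c p)
    then obtain s q where sq: "s \<in> S" "q \<in> polys_over A" "smult (to_fract s) p = map_poly to_fract q"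
      by (auto simp: pCons_in_polys_over_iff)
    obtain a t where at: "a \<in> A" "t \<in> S" "c = to_fract a / to_fract t"
      using pCons.prems by (auto simp: pCons_in_polys_over_iff localization_eq)
    \<comment> \<open>The new common denominator is \<open>t * s\<close>: the old coefficients are
      scaled by \<open>t\<close> and the numerator \<open>a\<close> by \<open>s\<close>.\<close>
    have "to_fract t \<noteq> 0" using at(2) zero by auto
    then have "to_fract (t * s) * c = to_fract (s * a)" by (simp add: at(3))
    moreover have "smult (to_fract (t * s)) p = map_poly to_fract (smult t q)"
      using sq(3) by (simp add: map_poly_hom_smult flip: smult_smult)
    ultimately have "smult (to_fract (t * s)) (pCons c p) = map_poly to_fract (pCons (s * a) (smult t q))"
      by (simp add: map_poly_pCons_hom)
    moreover have "pCons (s * a) (smult t q) \<in> polys_over A"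
      using at sq subset subring
      by (auto simp: pCons_in_polys_over_iff smult_in_polys_over is_subringD)
    ultimately show ?case using mult[OF at(2) sq(1)] by blast
  qed
  then show ?thesis using that by blast
qed

text \<open>Clearing denominators turns the leading coefficient 1 into an element of
  \<open>S\<close>, which can be divided out again in the localization. The right side involves
  \<open>S\<close> only through the coefficient at \<open>m\<close>, which makes the degree
  condition a closed one.\<close>

lemma root_of_monic_localization_iff:
  "root_of_monic (localization A S) m (to_fract b) \<longleftrightarrow>
   (\<exists>q\<in>polys_over A. coeff q m \<in> S \<and> degree q \<le> m \<and> poly q b = 0)"
proof
  interpret inj_comm_ring_hom "to_fract :: 'b \<Rightarrow> 'b fract" by (rule inj_comm_ring_hom_to_fract)
  {
    assume "root_of_monic (localization A S) m (to_fract b)"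
    then obtain p where p: "p \<in> polys_over (localization A S)" "lead_coeff p = 1" "degree p = m"
      "poly p (to_fract b) = 0" by (auto simp: root_of_monic_def)
    obtain s q where sq: "s \<in> S" "q \<in> polys_over A" "smult (to_fract s) p = map_poly to_fract q"
      using clear_denominators[OF p(1)] by blast
    have "to_fract s \<noteq> 0" using sq(1) zero by auto
    then have "degree q = m" using arg_cong[OF sq(3), of degree] p(3) by simp
    moreover have "coeff q m = s"
      using arg_cong[OF sq(3), of "\<lambda>p. coeff p m"] p(2,3) by simp
    moreover have "poly q b = 0"
      using arg_cong[OF sq(3), of "\<lambda>p. poly p (to_fract b)"] p(4) by simp
    ultimately show "\<exists>q\<in>polys_over A. coeff q m \<in> S \<and> degree q \<le> m \<and> poly q b = 0"
      using sq by auto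
  }
  {
    assume "\<exists>q\<in>polys_over A. coeff q m \<in> S \<and> degree q \<le> m \<and> poly q b = 0"
    then obtain q where q: "q \<in> polys_over A" "coeff q m \<in> S" "degree q \<le> m" "poly q b = 0"
      by blast
    then have "coeff q m \<noteq> 0" using zero by metis
    then have deg: "degree q = m" using q(3) le_degree by (metis le_antisym)
    let ?p = "smult (inverse (to_fract (coeff q m))) (map_poly to_fract q)"
    have "?p \<in> polys_over (localization A S)"
      using q(1) to_fract_in_localization inverse_in_localization[OF q(2)]
      by (intro smult_in_polys_over is_subring_localization') (auto simp: polys_over_def)
    moreover have "degree ?p = m" "lead_coeff ?p = 1" "poly ?p (to_fract b) = 0"
      using deg q(4) \<open>coeff q m \<noteq> 0\<close> by simp_all
    ultimately show "root_of_monic (localization A S) m (to_fract b)"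
      unfolding root_of_monic_def by blast
  }
qed

end

lemma multiplicative_subset_nonzero: "is_subring A \<Longrightarrow> multiplicative_subset A (A - {0})"
  by (auto simp: multiplicative_subset_def is_subringD)

lemma multiplicative_subset_Spec:
  assumes "is_subring A" "p \<in> Spec A"
  shows "multiplicative_subset A (A - p)"
proof -
  have P: "p \<subset> A" "0 \<in> p" "\<And>a x. a \<in> A \<Longrightarrow> x \<in> p \<Longrightarrow> a * x \<in> p"
    "\<And>x y. x \<in> A \<Longrightarrow> y \<in> A \<Longrightarrow> x * y \<in> p \<Longrightarrow> x \<in> p \<or> y \<in> p"
    using assms(2) by (auto simp: Spec_def prime_ideal_of_def)
  have "1 \<notin> p"
  proof
    assume "1 \<in> p"
    then have "a \<in> p" if "a \<in> A" for a using P(3)[OF that, of 1] by simp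
    then show False using P(1) by blast
  qed
  show ?thesis
  proof
    show "1 \<in> A - p" using \<open>1 \<notin> p\<close> is_subringD(1)[OF assms(1)] by simp
    show "s * t \<in> A - p" if "s \<in> A - p" "t \<in> A - p" for s t
      using that P(4)[of s t] is_subringD(4)[OF assms(1), of s t] by auto
  qed (use assms(1) P(2) in auto)
qed

lemma is_subfield_fraction_field:
  assumes "is_subring A"
  shows "is_subfield (fraction_field A)"
proof -
  interpret multiplicative_subset A "A - {0}" by (rule multiplicative_subset_nonzero[OF assms])
  have "inverse x \<in> fraction_field A" if x: "x \<in> fraction_field A" for x
  proof (cases "x = 0")
    case False
    obtain a s where as: "a \<in> A" "s \<in> A" "x = to_fract a / to_fract s"
      using x by (auto simp: fraction_field_def localization_eq)
    then have "a \<noteq> 0" "inverse x = to_fract s / to_fract a" using False by auto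
    then show ?thesis unfolding fraction_field_def using localizationI[of s A a "A - {0}"] as by simp
  qed (use x in simp)
  then show ?thesis
    using is_subring_localization' by (simp add: is_subfield_def fraction_field_def)
qed

text \<open>By integrality every denominator has a nonzero multiple in \<open>A\<close>, so L is the
  localization of B at the nonzero elements of \<open>A\<close>.\<close>

lemma integral_extension_fraction:
  fixes y :: "'b::idom fract"
  assumes "integral_extension A (UNIV :: 'b set)"
  obtains b s where "s \<in> A - {0}" "y = to_fract b / to_fract s"
proof -
  obtain u v where y: "y = Fraction_Field.Fract u v" "v \<noteq> 0" by (cases y)
  have "is_subring A" "integral_over A v" using assms by (auto simp: integral_extension_def)
  then obtain w where w: "v * w \<in> A" "v * w \<noteq> 0" using multiple_in_subring y(2) by metis
  have "y = to_fract (u * w) / to_fract (v * w)" using w(2) by (simp add: y(1) Fract_eq_divide)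
  then show ?thesis using that w by blast
qed

lemma integral_over_fraction_field:
  fixes y :: "'b::idom fract"
  assumes "integral_extension A (UNIV :: 'b set)"
  shows "integral_over (fraction_field A) y"
proof -
  have A: "is_subring A" using assms by (simp add: integral_extension_def)
  interpret multiplicative_subset A "A - {0}" by (rule multiplicative_subset_nonzero[OF A])
  obtain b s where y: "s \<in> A - {0}" "y = to_fract b / to_fract s"
    using integral_extension_fraction[OF assms] .
  obtain n where "root_of_monic A n b"
    using assms by (auto simp: integral_extension_def integral_over_iff)
  then have "root_of_monic (fraction_field A) n y"
    unfolding fraction_field_def y(2) using y(1)
    by (intro root_of_monic_divide root_of_monic_localization is_subring_localization') auto
  then show ?thesis by (auto simp: integral_over_iff)
qed

text \<open>Write an element of L as b/s with nonzero \<open>s\<close> in \<open>A\<close>. Over the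
  larger ring \<open>fraction_field A\<close> the division by \<open>s\<close> is free, so its
  degree is at most that of b/1 over the localization.\<close>

lemma (in multiplicative_subset) integral_degree_fraction_field_le:
  assumes "integral_extension A (UNIV :: 'b set)"
  shows "integral_degree (fraction_field A) UNIV
         \<le> integral_degree (localization A S) (localization UNIV S)"
  unfolding integral_degree_def
proof (rule SUP_mono)
  fix y :: "'b fract"
  \<comment> \<open>The denominator \<open>s\<close> need not lie in \<open>S\<close>, so a second
    instance is used to invert it.\<close>
  interpret frac: multiplicative_subset A "A - {0}"
    by (rule multiplicative_subset_nonzero[OF subring])
  note K = is_subfieldD(1)[OF is_subfield_fraction_field[OF subring]]
  obtain b s where y: "s \<in> A - {0}" "y = to_fract b / to_fract s"
    using integral_extension_fraction[OF assms] .
  have "integral_degree_elem (fraction_field A) y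
        \<le> integral_degree_elem (localization A S) (to_fract b)"
    unfolding y(2)
    by (intro integral_degree_elem_le frac.root_of_monic_divide y(1) K is_subring_localization'
        root_of_monic_subset[OF _ localization_subset_fraction_field])
      (auto simp: fraction_field_def)
  then show "\<exists>z\<in>localization UNIV S. integral_degree_elem (fraction_field A) y
        \<le> integral_degree_elem (localization A S) z"
    using to_fract_in_localization by blast
qed

section \<open>Upper semicontinuity for minimal integral degree and for simple extensions\<close>

lemma upper_semicontinuous_if_constant:
  assumes "\<And>x. x \<in> topspace T \<Longrightarrow> f x = c"
  shows "upper_semicontinuous T f"
  unfolding upper_semicontinuous_def
proof (intro allI impI)
  fix n :: nat
  have "{x \<in> topspace T. enat n \<le> f x} = (if enat n \<le> c then topspace T else {})"
    using assms by auto
  then show "closedin T {x \<in> topspace T. enat n \<le> f x}" by simp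
qed

lemma upper_semicontinuous_if_minimal_degree:
  assumes ext: "integral_extension A (UNIV :: 'b::idom set)"
    and min: "integral_degree (fraction_field A) (UNIV :: 'b fract set) = integral_degree A UNIV"
  shows "upper_semicontinuous (zariski_topology A)
           (\<lambda>p. integral_degree (localization A (A - p)) (localization UNIV (A - p)))"
proof (rule upper_semicontinuous_if_constant)
  have A: "is_subring A" using ext by (simp add: integral_extension_def)
  fix p assume "p \<in> topspace (zariski_topology A)"
  then interpret multiplicative_subset A "A - p"
    by (intro multiplicative_subset_Spec A) (simp add: topspace_zariski[OF A])
  show "integral_degree (localization A (A - p)) (localization UNIV (A - p)) = integral_degree A UNIV"
    using integral_degree_localization_le integral_degree_fraction_field_le[OF ext] min
    by (metis antisym)
qed

text \<open>Every numerator is a polynomial in \<open>b\<close> over \<open>A\<close>, so its degree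
  over the localization is at most that of b/1, also after division by \<open>s\<close>. The
  supremum is attained at b/1.\<close>

lemma (in multiplicative_subset) integral_degree_localization_simple:
  assumes "(UNIV :: 'b set) = ring_adjoin A b"
  shows "integral_degree (localization A S) (localization UNIV S)
         = integral_degree_elem (localization A S) (to_fract b)"
proof (rule antisym)
  interpret h: inj_comm_ring_hom "to_fract :: 'b \<Rightarrow> 'b fract" by (rule inj_comm_ring_hom_to_fract)
  note R = is_subring_localization'
  let ?R = "localization A S"
  have "integral_degree_elem ?R y \<le> integral_degree_elem ?R (to_fract b)"
    if yS: "y \<in> localization UNIV S" for y
  proof (rule integral_degree_elem_le[OF R R])
    fix n assume n: "root_of_monic ?R n (to_fract b)"
    obtain c s where y: "s \<in> S" "y = to_fract c / to_fract s"
      using yS by (auto simp: localization_eq)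
    obtain f where f: "f \<in> polys_over A" "c = poly f b"
      using assms by (auto simp: ring_adjoin_def)
    have "map_poly to_fract f \<in> polys_over ?R"
      using f(1) to_fract_in_localization by (auto simp: polys_over_def)
    then have "to_fract c \<in> ring_adjoin ?R (to_fract b)"
      unfolding ring_adjoin_def f(2) h.poly_map_poly[symmetric] by blast
    then show "root_of_monic ?R n y"
      unfolding y(2) by (intro root_of_monic_divide R order_refl y(1) root_of_monic_ring_adjoin[OF R n])
  qed
  then show "integral_degree ?R (localization UNIV S) \<le> integral_degree_elem ?R (to_fract b)"
    unfolding integral_degree_def by (rule SUP_least)
  show "integral_degree_elem ?R (to_fract b) \<le> integral_degree ?R (localization UNIV S)"
    unfolding integral_degree_def by (intro SUP_upper to_fract_in_localization UNIV_I)
qed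

lemma upper_semicontinuous_if_simple:
  assumes A: "is_subring A" and b: "(UNIV :: 'b::idom set) = ring_adjoin A b"
  shows "upper_semicontinuous (zariski_topology A)
           (\<lambda>p. integral_degree (localization A (A - p)) (localization UNIV (A - p)))"
  unfolding upper_semicontinuous_def closedin_zariski[OF A] topspace_zariski[OF A]
proof (intro allI impI)
  fix n :: nat assume "n \<ge> 1"
  then obtain m where m: "n = Suc m" by (cases n) auto
  let ?d = "\<lambda>p. integral_degree (localization A (A - p)) (localization UNIV (A - p))"
  \<comment> \<open>This set does not depend on \<open>p\<close>. A monic equation of degree
    \<open>m\<close> over the localization exists exactly if some element of it lies in
    \<open>A - p\<close>.\<close>
  let ?E = "{coeff q m | q. q \<in> polys_over A \<and> degree q \<le> m \<and> poly q b = 0}"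
  have E: "?E \<subseteq> A" by (auto simp: polys_over_def)
  have "enat n \<le> ?d p \<longleftrightarrow> ?E \<subseteq> p" if "p \<in> Spec A" for p
  proof -
    interpret multiplicative_subset A "A - p" by (rule multiplicative_subset_Spec[OF A that])
    have "enat n \<le> ?d p \<longleftrightarrow> \<not> ?d p \<le> enat m"
      unfolding m by (simp add: not_le Suc_ile_eq)
    also have "\<dots> \<longleftrightarrow> \<not> root_of_monic (localization A (A - p)) m (to_fract b)"
      by (simp add: integral_degree_localization_simple[OF b]
          integral_degree_elem_le_iff[OF is_subring_localization'])
    also have "\<dots> \<longleftrightarrow> ?E \<subseteq> p"
      unfolding root_of_monic_localization_iff using E by blast
    finally show ?thesis .
  qed
  then have "{p \<in> Spec A. enat n \<le> ?d p} = zero_locus A ?E" by (auto simp: zero_locus_def)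
  then show "\<exists>E\<subseteq>A. {p \<in> Spec A. enat n \<le> ?d p} = zero_locus A E" using E by blast
qed

section \<open>Integrally closed base rings\<close>

lemma inj_comm_ring_hom_to_ac: "inj_comm_ring_hom to_ac"
  by unfold_locales auto

text \<open>Over an algebraic closure, the roots of the minimal polynomial are also roots of a monic
  polynomial over \<open>R\<close>.\<close>

lemma integral_over_coeff_minimal_poly:
  fixes x :: "'a::field"
  assumes K: "is_subfield K" and R: "is_subring R" "R \<subseteq> K" and x: "integral_over R x"
    and g: "g \<in> polys_over K" "lead_coeff g = 1" "poly g x = 0"
    and min: "\<And>m. root_of_monic K m x \<Longrightarrow> degree g \<le> m"
  shows "integral_over R (coeff g i)"
proof -
  interpret h: inj_comm_ring_hom "to_ac :: 'a \<Rightarrow> 'a alg_closure" by (rule inj_comm_ring_hom_to_ac)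
  interpret mh: map_poly_inj_comm_ring_hom "to_ac :: 'a \<Rightarrow> 'a alg_closure" ..
  let ?S = "to_ac ` R" and ?G = "map_poly to_ac g"
  have S: "is_subring ?S" using R(1) h.comm_ring_hom_axioms by (intro is_subring_hom_image)
  obtain f where f: "f \<in> polys_over R" "lead_coeff f = 1" "poly f x = 0"
    using x by (auto simp: integral_over_iff root_of_monic_def)
  then have "f \<in> polys_over K" using R(2) by (auto simp: polys_over_def)
  then obtain q r where qr: "r \<in> polys_over K" "f = q * g + r" "\<And>i. i \<ge> degree g \<Longrightarrow> coeff r i = 0"
    using monic_division[OF is_subfieldD(1)[OF K] g(1,2)] by metis
  \<comment> \<open>The remainder vanishes at \<open>x\<close> and has degree below the minimal one.
    Hence \<open>g\<close> divides \<open>f\<close>, and every root of \<open>g\<close> is a root of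
    the monic \<open>f\<close> over \<open>R\<close>.\<close>
  have r0: "r = 0" using qr(2) f(3) g(3) by (intro eq_0_if_low_degree_root[OF K min qr(1) _ qr(3)]) auto
  have "g \<noteq> 0" using g(2) by auto
  then obtain rs where rs: "?G = (\<Prod>r\<in>#rs. [:-r, 1:])"
    using alg_closed_imp_factorization[of ?G] g(2) by auto
  have int: "integral_over ?S r" if "r \<in># rs" for r
  proof -
    have "poly ?G r = 0" using that by (simp add: rs poly_prod_mset image_iff prod_mset_zero_iff)
    then have "poly (map_poly to_ac f) r = 0" by (simp add: qr(2) r0 mh.hom_mult)
    moreover have "map_poly to_ac f \<in> polys_over ?S" using f(1) by (auto simp: polys_over_def)
    ultimately show ?thesis
      unfolding integral_over_iff using f(2) by (intro exI[of _ "degree (map_poly to_ac f)"] root_of_monicI) auto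
  qed
  let ?C = "{r. integral_over ?S r}"
  note C = is_subring_integral_closure[OF S]
  \<comment> \<open>All linear factors of \<open>?G\<close> have coefficients in the ring of
    integral elements, and so has their product.\<close>
  have "[:-r, 1:] \<in> polys_over ?C" if "r \<in># rs" for r
    using is_subringD(1,5)[OF C] int[OF that] is_subringD(2)[OF is_subring_polys_over[OF C]]
    by (simp add: pCons_in_polys_over_iff)
  then have "?G \<in> polys_over ?C"
    unfolding rs by (intro is_subring_prod_mset[OF is_subring_polys_over[OF C]])
  then have "integral_over ?S (to_ac (coeff g i))" by (simp add: polys_over_def)
  then show ?thesis
    by (simp add: integral_over_iff root_of_monic_hom[OF inj_comm_ring_hom_to_ac])
qed

lemma minimal_integral_degree_if_integrally_closed:
  assumes ext: "integral_extension A (UNIV :: 'b::idom set)" and closed: "integrally_closed A"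
  shows "integral_degree A UNIV \<le> integral_degree (fraction_field A) (UNIV :: 'b fract set)"
  unfolding integral_degree_def
proof (rule SUP_mono)
  fix b :: 'b
  let ?A = "to_fract ` A" and ?K = "fraction_field A"
  have A: "is_subring A" and int: "integral_over A b"
    using ext by (auto simp: integral_extension_def)
  interpret multiplicative_subset A "A - {0}" by (rule multiplicative_subset_nonzero[OF A])
  interpret h: inj_comm_ring_hom "to_fract :: 'b \<Rightarrow> 'b fract" by (rule inj_comm_ring_hom_to_fract)
  note K = is_subfield_fraction_field[OF A]
  have A': "is_subring ?A"
    by (rule is_subring_hom_image[OF h.comm_ring_hom_axioms A])
  have AK: "?A \<subseteq> ?K" unfolding fraction_field_def using to_fract_in_localization by blast
  obtain n where n: "root_of_monic ?K n (to_fract b)"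
    "\<And>m. root_of_monic ?K m (to_fract b) \<Longrightarrow> n \<le> m"
    using root_of_monic_least[OF integral_over_fraction_field[OF ext]] by blast
  then obtain g where g: "g \<in> polys_over ?K" "lead_coeff g = 1" "degree g = n" "poly g (to_fract b) = 0"
    by (auto simp: root_of_monic_def)
  have "integral_over ?A (to_fract b)"
    using int by (simp add: integral_over_iff root_of_monic_to_fract)
  then have "integral_over ?A (coeff g i)" for i
    using integral_over_coeff_minimal_poly[OF K A' AK _ g(1,2,4)] n(2) g(3) by blast
  moreover have "coeff g i \<in> ?K" for i using g(1) by (simp add: polys_over_def)
  ultimately have "g \<in> polys_over ?A"
    using closed by (simp add: integrally_closed_def polys_over_def to_fract_def[abs_def])
  then have "root_of_monic ?A n (to_fract b)" using g by (auto simp: root_of_monic_def)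
  then have "root_of_monic A n b" by (simp add: root_of_monic_to_fract)
  then have "integral_degree_elem A b \<le> enat n" by (simp add: integral_degree_elem_le_iff[OF A])
  also have "enat n \<le> integral_degree_elem ?K (to_fract b)"
    unfolding integral_degree_elem_def using n(2) by (intro Inf_greatest) auto
  finally show "\<exists>y\<in>UNIV. integral_degree_elem A b \<le> integral_degree_elem ?K y" by blast
qed

section \<open>Projective extensions\<close>

lemma char_poly_matrix_eq_minus:
  assumes "M \<in> carrier_mat n n"
  shows "char_poly_matrix M = monom 1 1 \<cdot>\<^sub>m 1\<^sub>m n - map_mat (\<lambda>a. [:a:]) M"
  using assms by (intro eq_matI) (auto simp: char_poly_matrix_def monom_altdef)

text \<open>The determinant of the block matrix \<open>W\<close> is computed in two ways.
  Multiplying by \<open>U\<close> clears the lower left block at determinant 1 and leaves the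
  characteristic polynomial of \<open>F * G\<close>; multiplying by \<open>V\<close> clears the
  upper right block at the cost of a factor T^m and leaves T^n times that of
  \<open>G * F\<close>.\<close>

lemma char_poly_mult_commute:
  fixes F G :: "'a::idom mat"
  assumes F: "F \<in> carrier_mat n m" and G: "G \<in> carrier_mat m n"
  shows "monom 1 m * char_poly (F * G) = monom 1 n * char_poly (G * F)"
proof -
  let ?c = "map_mat (\<lambda>a. [:a:])"
  let ?t = "monom 1 1 :: 'a poly"
  define P Q where "P = ?c F" and "Q = ?c G"
  have P: "P \<in> carrier_mat n m" and Q: "Q \<in> carrier_mat m n" using F G by (auto simp: P_def Q_def)
  have PQ: "P * Q = ?c (F * G)" "Q * P = ?c (G * F)"
    using map_poly_mult(1)[OF F G] map_poly_mult(1)[OF G F] by (simp_all add: P_def Q_def)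
  define W where "W = four_block_mat (?t \<cdot>\<^sub>m 1\<^sub>m n) P Q (1\<^sub>m m)"
  define U where "U = four_block_mat (1\<^sub>m n) (0\<^sub>m n m) (- Q) (1\<^sub>m m)"
  define V where "V = four_block_mat (1\<^sub>m n) (- P) (0\<^sub>m m n) (?t \<cdot>\<^sub>m 1\<^sub>m m)"
  have W: "W \<in> carrier_mat (n + m) (n + m)" unfolding W_def by auto
  have U: "U \<in> carrier_mat (n + m) (n + m)" unfolding U_def by auto
  have V: "V \<in> carrier_mat (n + m) (n + m)" unfolding V_def by auto
  have "W * U = four_block_mat (?t \<cdot>\<^sub>m 1\<^sub>m n - P * Q) P (0\<^sub>m m n) (1\<^sub>m m)"
    unfolding W_def U_def using P Q
    by (subst mult_four_block_mat[of _ n n _ m _ m _ _ n _ m])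
      (auto intro!: cong_four_block_mat)
  then have "det (W * U) = det (?t \<cdot>\<^sub>m 1\<^sub>m n - P * Q)"
    using P Q by (simp only:) (subst det_four_block_mat_lower_left_zero[of _ n _ m], auto)
  also have "\<dots> = char_poly (F * G)"
    using F G by (simp add: char_poly_def PQ char_poly_matrix_eq_minus[of _ n])
  finally have "det (W * U) = char_poly (F * G)" .
  moreover have "det U = 1"
    unfolding U_def using Q by (subst det_four_block_mat_upper_right_zero[of _ n]) auto
  ultimately have 1: "det W = char_poly (F * G)" using det_mult[OF W U] by simp
  have "W * V = four_block_mat (?t \<cdot>\<^sub>m 1\<^sub>m n) (0\<^sub>m n m) Q (?t \<cdot>\<^sub>m 1\<^sub>m m - Q * P)"
    unfolding W_def V_def using P Q
    by (subst mult_four_block_mat[of _ n n _ m _ m _ _ n _ m])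
      (auto intro!: cong_four_block_mat)
  then have "det (W * V) = ?t ^ n * det (?t \<cdot>\<^sub>m 1\<^sub>m m - Q * P)"
    using P Q by (simp only:) (subst det_four_block_mat_upper_right_zero[of _ n _ m], auto)
  also have "det (?t \<cdot>\<^sub>m 1\<^sub>m m - Q * P) = char_poly (G * F)"
    using F G by (simp add: char_poly_def PQ char_poly_matrix_eq_minus[of _ m])
  finally have "det (W * V) = ?t ^ n * char_poly (G * F)" .
  moreover have "det V = ?t ^ m"
    unfolding V_def using P by (subst det_four_block_mat_lower_left_zero[of _ n]) auto
  ultimately show ?thesis using det_mult[OF W V] 1 
    by (simp add: x_pow_n[unfolded One_nat_def] mult.commute)
qed

text \<open>The functionals are coordinates of the embedding \<open>\<iota>\<close> into a free
  module, and the vectors are the images under \<open>\<pi>\<close> of its standard basis.\<close>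

lemma dual_basis:
  fixes A :: "'b::idom set"
  assumes A: "is_subring A" and gen: "fin_gen_module A (UNIV :: 'b set)"
    and proj: "projective_module A (UNIV :: 'b set)"
  obtains \<phi> :: "nat \<Rightarrow> 'b \<Rightarrow> 'b" and u and N :: nat where
    "\<And>j x. \<phi> j x \<in> A" "\<And>j x y. \<phi> j (x + y) = \<phi> j x + \<phi> j y"
    "\<And>j a x. a \<in> A \<Longrightarrow> \<phi> j (a * x) = a * \<phi> j x" "\<And>x. x = (\<Sum>j<N. \<phi> j x * u j)"
proof -
  note D = is_subringD[OF A]
  from proj obtain I \<iota> \<pi> where
    "(\<forall>x\<in>(UNIV :: 'b set). \<iota> x \<in> free_module A (I :: 'b set)) \<and>
     (\<forall>x\<in>UNIV. \<forall>y\<in>UNIV. \<iota> (x + y) = (\<lambda>i. \<iota> x i + \<iota> y i)) \<and>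
     (\<forall>a\<in>A. \<forall>x\<in>UNIV. \<iota> (a * x) = (\<lambda>i. a * \<iota> x i)) \<and>
     (\<forall>f\<in>free_module A I. \<pi> f \<in> (UNIV :: 'b set)) \<and>
     (\<forall>f\<in>free_module A I. \<forall>g\<in>free_module A I. \<pi> (\<lambda>i. f i + g i) = \<pi> f + \<pi> g) \<and>
     (\<forall>a\<in>A. \<forall>f\<in>free_module A I. \<pi> (\<lambda>i. a * f i) = a * \<pi> f) \<and>
     (\<forall>x\<in>UNIV. \<pi> (\<iota> x) = x)"
    unfolding projective_module_def by (elim exE) (rule that)
  note this = conjunct1[OF this] conjunct2[OF this]
  note this = this(1) conjunct1[OF this(2)] conjunct2[OF this(2)]
  note this = this(1,2) conjunct1[OF this(3)] conjunct2[OF this(3)]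
  note this = this(1-3) conjunct2[OF this(4)]
  note this = this(1-3) conjunct1[OF this(4)] conjunct2[OF this(4)]
  note this = this(1-4) conjunct1[OF this(5)] conjunct2[OF this(5)]
  note \<iota> = this(1)[rule_format, OF UNIV_I] this(2)[rule_format, OF UNIV_I UNIV_I]
      this(3)[rule_format, OF _ UNIV_I] and \<pi> = this(4,5)[rule_format]
    and \<pi>\<iota> = this(6)[rule_format, OF UNIV_I]
  obtain S where S: "finite S" "\<And>x. \<exists>c. (\<forall>s\<in>S. c s \<in> A) \<and> x = (\<Sum>s\<in>S. c s * s)"
    using gen unfolding fin_gen_module_def by auto
  \<comment> \<open>These are the coordinates occurring in the finitely many generators; by
    linearity all others vanish on the whole module.\<close>
  define J where "J = (\<Union>s\<in>S. {i. \<iota> s i \<noteq> 0})"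
  have supp: "finite {i. \<iota> x i \<noteq> 0}" "{i. \<iota> x i \<noteq> 0} \<subseteq> I" and \<iota>A: "\<iota> x i \<in> A" for x i
    using \<iota>(1)[of x] by (auto simp: free_module_def)
  have J: "finite J" "J \<subseteq> I" unfolding J_def using S(1) supp by auto
  have \<iota>0: "\<iota> 0 i = 0" for i using \<iota>(3)[OF D(2), of 0] by simp
  have \<iota>_sum: "\<iota> (\<Sum>s\<in>T. f s) i = (\<Sum>s\<in>T. \<iota> (f s) i)" for T :: "'b set" and f i
    by (induction T rule: infinite_finite_induct) (simp_all add: \<iota>0 \<iota>(2))
  have \<iota>J: "\<iota> x i = 0" if "i \<notin> J" for x i
  proof -
    obtain c where c: "\<forall>s\<in>S. c s \<in> A" "x = (\<Sum>s\<in>S. c s * s)" using S(2) by blast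
    then show ?thesis using that by (simp add: \<iota>_sum \<iota>(3) J_def)
  qed
  define \<delta> :: "'b \<Rightarrow> 'b \<Rightarrow> 'b" where "\<delta> j = (\<lambda>i. if i = j then 1 else 0)" for j
  have free: "(\<lambda>i. if i \<in> T then c i else 0) \<in> free_module A I"
    if "finite T" "T \<subseteq> I" "\<And>i. c i \<in> A" for T c
    using that D(2) finite_subset[of "{i. i \<in> T \<and> c i \<noteq> 0}" T]
    by (auto simp: free_module_def)
  have \<delta>: "\<delta> j \<in> free_module A I" "(\<lambda>i. c * \<delta> j i) \<in> free_module A I" if "j \<in> I" "c \<in> A" for j c
    using free[of "{j}" "\<lambda>_. 1"] free[of "{j}" "\<lambda>_. c"] that D(1)
    by (auto simp: \<delta>_def if_distrib cong: if_cong)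
  have \<pi>_sum: "\<pi> (\<lambda>i. if i \<in> T then c i else 0) = (\<Sum>j\<in>T. c j * \<pi> (\<delta> j))"
    if "finite T" "T \<subseteq> I" "\<And>i. c i \<in> A" for T c
    using that(1,2)
  proof (induction T)
    case empty
    have "\<pi> (\<lambda>i. 0 * \<iota> 0 i) = 0 * \<pi> (\<iota> 0)" by (rule \<pi>(2)[OF D(2) \<iota>(1)])
    then show ?case by simp
  next
    case (insert j T)
    have "(\<lambda>i. if i \<in> insert j T then c i else 0)
        = (\<lambda>i. c j * \<delta> j i + (if i \<in> T then c i else 0))"
      using insert.hyps by (auto simp: \<delta>_def fun_eq_iff)
    then have "\<pi> (\<lambda>i. if i \<in> insert j T then c i else 0)
        = \<pi> (\<lambda>i. c j * \<delta> j i + (if i \<in> T then c i else 0))" by (rule arg_cong)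
    also have "\<dots> = \<pi> (\<lambda>i. c j * \<delta> j i) + \<pi> (\<lambda>i. if i \<in> T then c i else 0)"
      using insert.prems insert.hyps that(3) by (intro \<pi>(1) \<delta> free) auto
    also have "\<pi> (\<lambda>i. c j * \<delta> j i) = c j * \<pi> (\<delta> j)"
      using insert.prems that(3) by (intro \<pi>(2) \<delta>[OF _ D(1)]) auto
    finally show ?case using insert by simp
  qed
  obtain h and N :: nat where h: "bij_betw h {..<N} J"
    using ex_bij_betw_nat_finite[OF J(1)] by (auto simp: atLeast0LessThan)
  show ?thesis
  proof
    show "\<iota> x (h j) \<in> A" "\<iota> (x + y) (h j) = \<iota> x (h j) + \<iota> y (h j)" for j x y
      by (simp_all add: \<iota>A \<iota>(2))
    show "\<iota> (a * x) (h j) = a * \<iota> x (h j)" if "a \<in> A" for a j x by (simp add: \<iota>(3)[OF that])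
    fix x
    have "\<iota> x = (\<lambda>i. if i \<in> J then \<iota> x i else 0)" using \<iota>J by auto
    then have "x = (\<Sum>j\<in>J. \<iota> x j * \<pi> (\<delta> j))"
      using \<pi>_sum[OF J, of "\<iota> x"] \<pi>\<iota>[of x] \<iota>A by simp
    also have "\<dots> = (\<Sum>j<N. \<iota> x (h j) * \<pi> (\<delta> (h j)))"
      by (rule sum.reindex_bij_betw[OF h, symmetric])
    finally show "x = (\<Sum>j<N. \<iota> x (h j) * \<pi> (\<delta> (h j)))" .
  qed
qed

text \<open>With a dual basis of \<open>B\<close> and the \<open>K\<close>-basis of powers of \<open>\<beta>\<close>, multiplication by \<open>b\<close> has a
  matrix \<open>C\<close> over \<open>K\<close> and a matrix \<open>P C Q\<close> over \<open>A\<close>, where \<open>Q P = 1\<close>. Hence their characteristic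
  polynomials differ only by a power of the indeterminate.\<close>

lemma root_of_monic_if_projective:
  fixes A :: "'b::idom set"
  assumes A: "is_subring A" and gen: "fin_gen_module A (UNIV :: 'b set)"
    and proj: "projective_module A (UNIV :: 'b set)"
    and simple: "ring_adjoin (fraction_field A) (to_fract t) = UNIV"
    and n: "root_of_monic (fraction_field A) n (to_fract t)"
    and min: "\<And>m. root_of_monic (fraction_field A) m (to_fract t) \<Longrightarrow> n \<le> m"
  shows "root_of_monic A n b"
proof -
  let ?K = "fraction_field A"
  define \<beta> where "\<beta> = to_fract t"
  interpret multiplicative_subset A "A - {0}" by (rule multiplicative_subset_nonzero[OF A])
  interpret h: inj_comm_ring_hom "to_fract :: 'b \<Rightarrow> 'b fract" by (rule inj_comm_ring_hom_to_fract)
  note K = is_subfield_fraction_field[OF A]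
  note K' = is_subfieldD(1)[OF K]
  have eK: "to_fract a \<in> ?K" if "a \<in> A" for a
    unfolding fraction_field_def using that by (rule to_fract_in_localization)
  note inject = power_sum_inject[OF K min[folded \<beta>_def], where x = \<beta>]
  obtain \<phi> :: "nat \<Rightarrow> 'b \<Rightarrow> 'b" and u and N :: nat where
    \<phi>: "\<And>j x. \<phi> j x \<in> A" "\<And>j x y. \<phi> j (x + y) = \<phi> j x + \<phi> j y"
    "\<And>j a x. a \<in> A \<Longrightarrow> \<phi> j (a * x) = a * \<phi> j x" and dual: "\<And>x. x = (\<Sum>j<N. \<phi> j x * u j)"
    by (rule dual_basis[OF A gen proj], rule that)
  have \<phi>0: "\<phi> j 0 = 0" for j using \<phi>(3)[of 0 j 0] is_subringD(2)[OF A] by simp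
  have \<phi>_sum: "\<phi> j (\<Sum>i<m. f i) = (\<Sum>i<m. \<phi> j (f i))" for j m and f :: "nat \<Rightarrow> 'b"
    by (induction m) (simp_all add: \<phi>0 \<phi>(2))
  have "\<exists>c. (\<forall>i. c i \<in> ?K) \<and> y = (\<Sum>i<n. c i * \<beta> ^ i)" for y
    using ring_adjoin_power_sum[OF K' n, of y] simple unfolding \<beta>_def by (metis UNIV_I)
  then obtain c where cK: "\<And>y i. c y i \<in> ?K" and c: "\<And>y. y = (\<Sum>i<n. c y i * \<beta> ^ i)" by metis
  \<comment> \<open>This says that \<open>\<phi> j\<close> extends K-linearly to L. The coordinates
    of \<open>x\<close> in the powers of \<open>\<beta>\<close> get a common denominator
    \<open>s\<close>, linearity over \<open>A\<close> is applied to \<open>s * x\<close>, and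
    \<open>s\<close> is cancelled. The powers of \<open>t\<close> lie in B, where
    \<open>\<phi> j\<close> is defined.\<close>
  have expand: "to_fract (\<phi> j x) = (\<Sum>i<n. c (to_fract x) i * to_fract (\<phi> j (t ^ i)))" for j x
  proof -
    let ?p = "\<Sum>i<n. monom (c (to_fract x) i) i"
    have coeff_p: "coeff ?p i = (if i < n then c (to_fract x) i else 0)" for i
      by (auto simp: coeff_sum coeff_monom)
    have "?p \<in> polys_over (localization A (A - {0}))"
      using cK is_subringD(2)[OF K'] by (auto simp: polys_over_def coeff_p fraction_field_def)
    then obtain s q where sq: "s \<in> A - {0}" "q \<in> polys_over A"
      "smult (to_fract s) ?p = map_poly to_fract q" by (rule clear_denominators)
    have q: "to_fract s * c (to_fract x) i = to_fract (coeff q i)" if "i < n" for i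
      using arg_cong[OF sq(3), of "\<lambda>p. coeff p i"] that by (simp add: coeff_p)
    have "to_fract (s * x) = to_fract s * (\<Sum>i<n. c (to_fract x) i * \<beta> ^ i)"
      by (simp add: c[symmetric])
    also have "\<dots> = (\<Sum>i<n. to_fract (coeff q i * t ^ i))"
      unfolding sum_distrib_left by (intro sum.cong) (auto simp: q \<beta>_def h.hom_power mult.assoc[symmetric])
    also have "\<dots> = to_fract (\<Sum>i<n. coeff q i * t ^ i)" by (simp add: h.hom_sum)
    finally have "s * x = (\<Sum>i<n. coeff q i * t ^ i)" by (simp only: to_fract_eq_iff)
    then have "\<phi> j (s * x) = (\<Sum>i<n. coeff q i * \<phi> j (t ^ i))"
      using sq(2) by (simp add: \<phi>_sum \<phi>(3) polys_over_def)
    then have "s * \<phi> j x = (\<Sum>i<n. coeff q i * \<phi> j (t ^ i))" using \<phi>(3)[of s] sq(1) by simp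
    then have "to_fract (s * \<phi> j x) = to_fract (\<Sum>i<n. coeff q i * \<phi> j (t ^ i))" by simp
    also have "\<dots> = (\<Sum>i<n. to_fract (coeff q i) * to_fract (\<phi> j (t ^ i)))" by (simp add: h.hom_sum)
    also have "\<dots> = to_fract s * (\<Sum>i<n. c (to_fract x) i * to_fract (\<phi> j (t ^ i)))"
      unfolding sum_distrib_left by (intro sum.cong) (auto simp flip: q)
    finally show ?thesis using sq(1) by simp
  qed
  \<comment> \<open>Rows hold coordinates: \<open>P\<close> of \<open>u k\<close>, \<open>C\<close>
    of \<open>b * \<beta> ^ i\<close> and \<open>D\<close> of \<open>b * u k\<close> in the powers
    of \<open>\<beta>\<close>; \<open>Q\<close> of \<open>t ^ i\<close> and \<open>M\<close> of
    \<open>b * u k\<close> in the dual basis.\<close>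
  define P where "P = mat N n (\<lambda>(k, i). c (to_fract (u k)) i)"
  define Q where "Q = mat n N (\<lambda>(i, j). to_fract (\<phi> j (t ^ i)))"
  define C where "C = mat n n (\<lambda>(i, l). c (to_fract b * \<beta> ^ i) l)"
  define D where "D = mat N n (\<lambda>(k, i). c (to_fract (b * u k)) i)"
  define M where "M = mat N N (\<lambda>(k, j). to_fract (\<phi> j (b * u k)))"
  have carrier: "P \<in> carrier_mat N n" "Q \<in> carrier_mat n N" "C \<in> carrier_mat n n"
    "D \<in> carrier_mat N n" "M \<in> carrier_mat N N"
    by (simp_all add: P_def Q_def C_def D_def M_def)
  \<comment> \<open>Expanding \<open>t ^ i\<close> in the dual basis and then each
    \<open>u j\<close> in powers of \<open>\<beta>\<close> must return the single power, since
    coordinates are unique.\<close>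
  have QP: "Q * P = 1\<^sub>m n"
  proof (rule eq_matI)
    fix i l assume "i < dim_row (1\<^sub>m n :: 'b fract mat)" "l < dim_col (1\<^sub>m n :: 'b fract mat)"
    then have il: "i < n" "l < n" by auto
    let ?a = "\<lambda>l. \<Sum>j<N. to_fract (\<phi> j (t ^ i)) * c (to_fract (u j)) l"
    have "(\<Sum>l<n. ?a l * \<beta> ^ l) = (\<Sum>j<N. to_fract (\<phi> j (t ^ i)) * (\<Sum>l<n. c (to_fract (u j)) l * \<beta> ^ l))"
      unfolding sum_distrib_left sum_distrib_right by (subst sum.swap) (simp add: mult.assoc)
    also have "\<dots> = (\<Sum>j<N. to_fract (\<phi> j (t ^ i) * u j))" by (simp add: c[symmetric])
    also have "\<dots> = to_fract (t ^ i)" by (simp only: h.hom_sum[symmetric] dual[symmetric])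
    also have "\<dots> = (\<Sum>l<n. (if l = i then 1 else 0) * \<beta> ^ l)"
      using il by (simp add: \<beta>_def h.hom_power if_distrib[of "\<lambda>x. x * _"] sum.delta cong: if_cong)
    finally have "?a l = (if l = i then 1 else 0)"
      using il(2) eK \<phi>(1) cK is_subringD(1,2,4)[OF K']
      by (intro inject[where a = ?a and b = "\<lambda>l. if l = i then 1 else 0"]) (auto intro!: is_subring_sum[OF K'])
    then show "(Q * P) $$ (i, l) = 1\<^sub>m n $$ (i, l)"
      using il by (auto simp: Q_def P_def scalar_prod_def atLeast0LessThan)
  qed (simp_all add: Q_def P_def)
  have PC: "P * C = D"
  proof (rule eq_matI)
    fix k l assume "k < dim_row D" "l < dim_col D"
    then have kl: "k < N" "l < n" by (auto simp: D_def)
    let ?a = "\<lambda>l. \<Sum>i<n. c (to_fract (u k)) i * c (to_fract b * \<beta> ^ i) l"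
    have "(\<Sum>l<n. ?a l * \<beta> ^ l) = (\<Sum>i<n. c (to_fract (u k)) i * (\<Sum>l<n. c (to_fract b * \<beta> ^ i) l * \<beta> ^ l))"
      unfolding sum_distrib_left sum_distrib_right by (subst sum.swap) (simp add: mult.assoc)
    also have "\<dots> = (\<Sum>i<n. c (to_fract (u k)) i * (to_fract b * \<beta> ^ i))" by (simp add: c[symmetric])
    also have "\<dots> = to_fract b * (\<Sum>i<n. c (to_fract (u k)) i * \<beta> ^ i)"
      by (simp add: sum_distrib_left mult_ac)
    also have "\<dots> = (\<Sum>l<n. c (to_fract (b * u k)) l * \<beta> ^ l)"
      by (simp add: c[symmetric])
    finally have "?a l = c (to_fract (b * u k)) l"
      using kl(2) cK is_subringD(4)[OF K']
      by (intro inject[where a = ?a and b = "c (to_fract (b * u k))"]) (auto intro!: is_subring_sum[OF K'])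
    then show "(P * C) $$ (k, l) = D $$ (k, l)"
      using kl by (auto simp: D_def C_def P_def scalar_prod_def atLeast0LessThan)
  qed (simp_all add: D_def C_def P_def)
  have "M = D * Q"
  proof (rule eq_matI)
    fix k j assume "k < dim_row (D * Q)" "j < dim_col (D * Q)"
    then have "k < N" "j < N" by (auto simp: D_def Q_def)
    then show "M $$ (k, j) = (D * Q) $$ (k, j)"
      using expand[of j "b * u k"]
      by (simp add: M_def D_def Q_def scalar_prod_def atLeast0LessThan del: to_fract_mult)
  qed (simp_all add: M_def D_def Q_def)
  also have "\<dots> = P * (C * Q)" unfolding PC[symmetric] using carrier by simp
  finally have "monom 1 n * char_poly M = monom 1 N * char_poly (C * Q * P)"
    using carrier char_poly_mult_commute[of P N n "C * Q"] by simp
  also have "C * Q * P = C" using carrier QP by simp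
  finally have char: "monom 1 n * char_poly M = monom 1 N * char_poly C" .
  have A': "is_subring (to_fract ` A)"
    by (rule is_subring_hom_image[OF h.comm_ring_hom_axioms A])
  have M: "char_poly M \<in> polys_over (to_fract ` A)"
    by (rule char_poly_in_polys_over[OF A' carrier(5)]) (simp add: M_def \<phi>(1))
  have "char_poly C \<in> polys_over (to_fract ` A)"
    unfolding polys_over_def
  proof (intro CollectI allI)
    fix i
    \<comment> \<open>Multiplication by a monomial only shifts coefficients, so this one is either
      zero or a coefficient of \<open>char_poly M\<close>.\<close>
    have "coeff (char_poly C) i = coeff (monom 1 N * char_poly C) (i + N)"
      by (simp add: coeff_monom_mult)
    also have "\<dots> \<in> to_fract ` A"
      unfolding char[symmetric] coeff_monom_mult
      using M is_subringD(2)[OF A'] by (auto simp: polys_over_def)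
    finally show "coeff (char_poly C) i \<in> to_fract ` A" .
  qed
  moreover have "poly (char_poly C) (to_fract b) = 0"
  proof (rule poly_char_poly_eq_0[OF carrier(3), of 0])
    show "0 < n" using n by (cases n) auto
    show "\<beta> ^ 0 \<noteq> 0" by simp
    show "to_fract b * \<beta> ^ i = (\<Sum>l<n. C $$ (i, l) * \<beta> ^ l)" if "i < n" for i
      using that by (simp add: C_def c[symmetric])
  qed
  ultimately have "root_of_monic (to_fract ` A) n (to_fract b)"
    using root_of_monicI[of "char_poly C"] degree_monic_char_poly[OF carrier(3)] by metis
  then show ?thesis by (simp add: root_of_monic_to_fract)
qed

text \<open>Clearing the denominator of \<open>\<alpha>\<close> gives a generator of L over K that
  comes from B. Its degree over K bounds the degrees over \<open>A\<close> of all elements of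
  B.\<close>

lemma minimal_integral_degree_if_projective:
  assumes ext: "integral_extension A (UNIV :: 'b::idom set)"
    and gen: "fin_gen_module A (UNIV :: 'b set)"
    and proj: "projective_module A (UNIV :: 'b set)"
    and simple: "(UNIV :: 'b fract set) = field_adjoin (fraction_field A) \<alpha>"
  shows "integral_degree A UNIV \<le> integral_degree (fraction_field A) (UNIV :: 'b fract set)"
proof -
  let ?K = "fraction_field A"
  have A: "is_subring A" using ext by (simp add: integral_extension_def)
  interpret multiplicative_subset A "A - {0}" by (rule multiplicative_subset_nonzero[OF A])
  note K = is_subfield_fraction_field[OF A]
  note K' = is_subfieldD(1)[OF K]
  obtain t s where s: "s \<in> A - {0}" "\<alpha> = to_fract t / to_fract s"
    using integral_extension_fraction[OF ext] .
  let ?F = "ring_adjoin ?K (to_fract t)"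
  note F = is_subfield_ring_adjoin[OF K integral_over_fraction_field[OF ext]]
  have "to_fract s \<in> ?F"
    using to_fract_in_localization[of s A] s(1) subset_ring_adjoin[OF K']
    by (auto simp: fraction_field_def)
  then have "\<alpha> \<in> ?F" unfolding s(2) by (intro is_subfieldD(3)[OF F] ring_adjoin_self[OF K'])
  then have "field_adjoin ?K \<alpha> \<subseteq> ?F"
    unfolding field_adjoin_def using F subset_ring_adjoin[OF K'] by blast
  then have F_UNIV: "?F = UNIV" using simple by auto
  obtain n where n: "root_of_monic ?K n (to_fract t)"
    "\<And>m. root_of_monic ?K m (to_fract t) \<Longrightarrow> n \<le> m"
    using root_of_monic_least[OF integral_over_fraction_field[OF ext]] by blast
  have "integral_degree_elem A b \<le> enat n" for b :: 'b
    using root_of_monic_if_projective[OF A gen proj F_UNIV n]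
    by (simp add: integral_degree_elem_le_iff[OF A])
  then have "integral_degree A (UNIV :: 'b set) \<le> enat n"
    unfolding integral_degree_def by (intro SUP_least)
  also have "\<dots> \<le> integral_degree_elem ?K (to_fract t)"
    unfolding integral_degree_elem_def using n(2) by (intro Inf_greatest) auto
  also have "\<dots> \<le> integral_degree ?K UNIV" unfolding integral_degree_def by (intro SUP_upper) simp
  finally show ?thesis .
qed

theorem proposition7p1:
  fixes A :: "'b::idom set"
  assumes "integral_extension A (UNIV :: 'b set)"
  shows
    "let B = (UNIV :: 'b set);
         K = fraction_field A;
         L = (UNIV :: 'b fract set);
         d = (\<lambda>p. integral_degree (localization A (A - p)) (localization B (A - p)));
         usc = upper_semicontinuous (zariski_topology A) d
     in ((\<exists>b. B = ring_adjoin A b) \<longrightarrow> usc) \<and>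
        (integral_degree K L = integral_degree A B \<longrightarrow> usc) \<and>
        (fin_gen_module A B \<and> projective_module A B \<and> (\<exists>\<alpha>. L = field_adjoin K \<alpha>)
           \<longrightarrow> integral_degree K L = integral_degree A B) \<and>
        (integrally_closed A \<longrightarrow> integral_degree K L = integral_degree A B)"
proof -
  have A: "is_subring A" using assms by (simp add: integral_extension_def)
  \<comment> \<open>Localizing at the nonzero elements of \<open>A\<close> supplies the intermediate
    term in the chain of inequalities for \<open>le\<close>.\<close>
  interpret multiplicative_subset A "A - {0}" by (rule multiplicative_subset_nonzero[OF A])
  have le: "integral_degree (fraction_field A) (UNIV :: 'b fract set) \<le> integral_degree A (UNIV :: 'b set)"
    using integral_degree_fraction_field_le[OF assms] integral_degree_localization_le by (rule order_trans)
  show ?thesis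
    unfolding Let_def
    using upper_semicontinuous_if_simple[OF A] upper_semicontinuous_if_minimal_degree[OF assms]
      antisym[OF le minimal_integral_degree_if_projective[OF assms]]
      antisym[OF le minimal_integral_degree_if_integrally_closed[OF assms]]
    by blast
qed

end
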